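(* Let $(n_k)_{k\ge 0}$ be a strictly increasing sequence of positive integers with $n_0=1$. The following assertions are equivalent: (a) Every bounded linear operator $A$ on a complex Hilbert space for which $\operatorname{Re}A^{n_k}\ge 0$ for every $k\ge 0$ is a positive operator; (b) Every complex number $c$ with $\operatorname{Re}c^{n_k}\ge 0$ for every $k\ge 0$ is real and satisfies $c\ge 0$; (c) Every $\lambda\in\mathbb{C}$ with $|\lambda|=1$ such that $\sup_{k\ge 0}|\lambda^{n_k}-1|\le\sqrt{2}$ satisfies $\lambda=1$.
   Context: For a bounded linear operator $B$ on a complex Hilbert space $H$, $\operatorname{Re}B=(B+B^* )/2$, and $B$ is positive (written $B\ge 0$) if $\langle Bx,x\rangle\ge 0$ for every $x\in H$. *)

theory Defs
  imports "HOL-Analysis.Analysis" "HOL-Algebra.Algebraic_Closure_Type"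
begin

(* HOL-Analysis has no complex inner product spaces, so complex Hilbert spaces are set up
   with explicit carriers on top of the modules of HOL-Algebra; this also makes it possible
   to quantify over all of them inside a formula. As for every HOL-Algebra module, the
   multiplicative fields of the underlying ring record carry no meaning. *)

record 'a hilbert = "(complex, 'a) module" +
  cinner :: "'a \<Rightarrow> 'a \<Rightarrow> complex"

definition hnorm :: "'a hilbert \<Rightarrow> 'a \<Rightarrow> real" where
  "hnorm H x = sqrt (Re (cinner H x x))"

(* Set to 0 off the carrier, because the library locale Metric_space requires
   nonnegativity and symmetry of the distance on the whole type. *)
definition hdist :: "'a hilbert \<Rightarrow> 'a \<Rightarrow> 'a \<Rightarrow> real" where
  "hdist H x y =
     (if x \<in> carrier H \<and> y \<in> carrier H then hnorm H (x \<ominus>\<^bsub>H\<^esub> y) else 0)"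

locale complex_hilbert_space =
  module "ring_of_type_algebra :: complex ring" H for H :: "'a hilbert" (structure) +
  assumes cinner_add_left:
      "\<lbrakk>x \<in> carrier H; y \<in> carrier H; z \<in> carrier H\<rbrakk>
        \<Longrightarrow> cinner H (x \<oplus> y) z = cinner H x z + cinner H y z"
    and cinner_smult_left:
      "\<lbrakk>x \<in> carrier H; y \<in> carrier H\<rbrakk>
        \<Longrightarrow> cinner H (c \<odot> x) y = c * cinner H x y"
    and cinner_cnj:
      "\<lbrakk>x \<in> carrier H; y \<in> carrier H\<rbrakk> \<Longrightarrow> cinner H y x = cnj (cinner H x y)"
    and cinner_self_nonneg:
      "x \<in> carrier H \<Longrightarrow> cinner H x x \<in> \<real>\<^sub>\<ge>\<^sub>0"
    and cinner_self_eq_0: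
      "\<lbrakk>x \<in> carrier H; cinner H x x = 0\<rbrakk> \<Longrightarrow> x = \<zero>"
    and complete: "Metric_space.mcomplete (carrier H) (hdist H)"

(* Operators are functions on the whole type; only their values on the carrier matter. *)
definition bounded_operator :: "'a hilbert \<Rightarrow> ('a \<Rightarrow> 'a) \<Rightarrow> bool" where
  "bounded_operator H B \<longleftrightarrow>
     B \<in> carrier H \<rightarrow> carrier H \<and>
     (\<forall>x\<in>carrier H. \<forall>y\<in>carrier H. B (x \<oplus>\<^bsub>H\<^esub> y) = B x \<oplus>\<^bsub>H\<^esub> B y) \<and>
     (\<forall>c. \<forall>x\<in>carrier H. B (c \<odot>\<^bsub>H\<^esub> x) = c \<odot>\<^bsub>H\<^esub> B x) \<and>
     (\<exists>K. \<forall>x\<in>carrier H. hnorm H (B x) \<le> K * hnorm H x)"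

(* For a bounded operator on a Hilbert space the described vector exists and is unique. *)
definition adjoint_operator :: "'a hilbert \<Rightarrow> ('a \<Rightarrow> 'a) \<Rightarrow> 'a \<Rightarrow> 'a" where
  "adjoint_operator H B y =
     (THE z. z \<in> carrier H \<and> (\<forall>x\<in>carrier H. cinner H (B x) y = cinner H x z))"

definition Re_operator :: "'a hilbert \<Rightarrow> ('a \<Rightarrow> 'a) \<Rightarrow> 'a \<Rightarrow> 'a" where
  "Re_operator H B x = (1 / 2) \<odot>\<^bsub>H\<^esub> (B x \<oplus>\<^bsub>H\<^esub> adjoint_operator H B x)"

definition positive_operator :: "'a hilbert \<Rightarrow> ('a \<Rightarrow> 'a) \<Rightarrow> bool" where
  "positive_operator H B \<longleftrightarrow> (\<forall>x\<in>carrier H. cinner H (B x) x \<in> \<real>\<^sub>\<ge>\<^sub>0)"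

end

theory Submission
  imports Defs "HOL-Complex_Analysis.Complex_Analysis"
begin

text \<open>
  The scalar conditions are related by normalisation: for a unimodular number \<open>w\<close> one has
  \<open>\<bar>w - 1\<bar>\<^sup>2 = 2 - 2 Re w\<close>, so \<open>\<bar>w - 1\<bar> \<le> \<surd>2\<close> says exactly \<open>Re w \<ge> 0\<close>, and for
  \<open>c \<noteq> 0\<close> the condition \<open>Re c\<^sup>n \<ge> 0\<close> depends only on \<open>c / \<bar>c\<bar>\<close>.  Multiplication by \<open>c\<close> on the one-dimensional Hilbert space
  shows that the operator assertion implies the scalar ones.

  For the remaining implication let \<open>A\<close> be such that every \<open>A\<^sup>n\<close>, for \<open>n\<close> in the sequence, is accretive,
  that is, has positive real part.  If \<open>w\<close> is not a nonnegative real, the scalar assertion provides an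
  \<open>n\<close> in the sequence with \<open>Re w\<^sup>n < 0\<close>; then \<open>A\<^sup>n - w\<^sup>n\<close> is invertible, and so is its factor \<open>A - w\<close>.
  Hence the spectrum of \<open>A\<close> lies in \<open>[0,\<infinity>)\<close>, which makes \<open>A\<close> the principal \<open>m\<close>-th root of
  \<open>A\<^sup>m\<close> for every \<open>m\<close>.  A principal \<open>m\<close>-th root of an accretive operator has its numerical range in the sector
  \<open>\<bar>arg\<bar> \<le> \<pi>/(2m)\<close>.  Letting \<open>m\<close> run to infinity along the sequence squeezes the
  numerical range of \<open>A\<close> into \<open>[0,\<infinity>)\<close>.

  The sector bound rests on the Balakrishnan formula, which for \<open>\<bar>\<phi>\<bar> < \<pi>/2\<close> reads
  \<open>\<pi>/(m sin(\<pi>/m)) A = e\<^sup>i\<^sup>\<phi>\<^sup>/\<^sup>m \<integral> A\<^sup>m (A\<^sup>m + r\<^sup>m e\<^sup>i\<^sup>\<phi>)\<^sup>-\<^sup>1 dr\<close> over \<open>r > 0\<close>: the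
  integrand becomes accretive after multiplication by \<open>e\<^sup>i\<^sup>\<phi>\<close>.  The proof needs no vector-valued
  integrals.  With \<open>p(z) = \<langle>e\<^sup>z A (e\<^sup>z + A)\<^sup>-\<^sup>1 x, x\<rangle>\<close>, which is holomorphic on the strip \<open>\<bar>Im z\<bar> < \<pi>\<close>,
  partial fractions turn the integrand into a sum of values of \<open>p\<close> on \<open>m\<close> equally spaced horizontal lines,
  weighted by roots of unity (lemma \<open>rotated_resolvents_nonneg\<close>).  A primitive of \<open>p\<close>, summed over these lines
  with the same weights, has monotone real part, and its limits at both ends of the strip follow from
  those of \<open>p\<close>, namely \<open>\<langle>A x, x\<rangle>\<close> on the right and \<open>0\<close> on the left (lemma \<open>rotated_strip_sum\<close>).

  The limit on the left is the delicate one, because near its spectral point \<open>0\<close> the resolvent is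
  only known to grow at most polynomially.  It exists for \<open>x\<close> in the range of a high power of \<open>A\<close>
  (lemma \<open>resolvent_form_at_bot\<close>), and accretivity of \<open>A\<close> itself extends the resulting inequality
  to all vectors (lemma \<open>sector_bound_range_Suc\<close>).
\<close>

section \<open>Roots of unity and functions on a strip\<close>

lemma sum_index_mult_root_of_unity:
  fixes q :: "'a :: field"
  assumes "q ^ m = 1" and "q \<noteq> 1"
  shows "(\<Sum>j<m. of_nat j * q ^ j) = of_nat m / (q - 1)"
proof -
  have "(q - 1) * (\<Sum>j<l. of_nat j * q ^ j) = of_nat l * q ^ l - q * (\<Sum>j<l. q ^ j)" for l
    by (induction l) (simp_all add: algebra_simps)
  moreover have "(\<Sum>j<m. q ^ j) = 0"
    using geometric_sum[OF assms(2), of m] assms(1) by simp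
  ultimately have "(q - 1) * (\<Sum>j<m. of_nat j * q ^ j) = of_nat m"
    using assms(1) by simp
  then show ?thesis
    using assms(2) by (simp add: field_simps)
qed

lemma cis_minus_one_half_angle: "cis (- 2 * x) - 1 = - 2 * \<i> * sin x * cis (- x)"
proof -
  have "cis (- 2 * x) - 1 = cis (- x) * (cis (- x) - cis x)"
    by (simp add: cis_mult algebra_simps)
  also have "cis (- x) - cis x = - 2 * \<i> * sin x"
    by (simp add: complex_eq_iff)
  finally show ?thesis by simp
qed

lemma sum_roots_of_unity_power:
  assumes "0 < l" and "l < m"
  shows "(\<Sum>j<m. cis (2 * pi * real j / real m) ^ l) = 0"
proof -
  define \<omega> where "\<omega> = cis (2 * (pi * real l / real m))"
  have pow: "cis (2 * pi * real j / real m) ^ l = \<omega> ^ j" for j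
    by (simp add: \<omega>_def Complex.DeMoivre field_simps)
  have "pi * real l / real m < pi"
    using assms by (simp add: pos_divide_less_eq)
  then have "0 < sin (pi * real l / real m)"
    using assms by (intro sin_gt_zero) auto
  then have "cis (- 2 * (pi * real l / real m)) \<noteq> 1"
    using cis_minus_one_half_angle[of "pi * real l / real m"] by auto
  then have "inverse \<omega> \<noteq> 1"
    by (simp add: \<omega>_def)
  then have "\<omega> \<noteq> 1" by auto
  moreover have "\<omega> ^ m = 1"
  proof -
    have "\<omega> ^ m = cis (2 * pi * real l)"
      using assms by (simp add: \<omega>_def Complex.DeMoivre mult.assoc del: cis_multiple_2pi)
    then show ?thesis by (simp only: cis_multiple_2pi Ints_of_nat)
  qed
  ultimately show ?thesis
    unfolding pow using geometric_sum[of \<omega> m] by simp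
qed

text \<open>
  Let \<open>\<Phi>\<close> be a primitive of \<open>p\<close> and \<open>q\<close> the root of unity \<open>cis (- 2 pi / m)\<close>.  The hypothesis says that the real
  part of \<open>\<gamma> \<Sum> q\<^sup>j \<Phi>(t + \<i> \<beta>\<^sub>j)\<close> increases with \<open>t\<close>.  Since \<open>\<Sum> q\<^sup>j = 0\<close>, only the
  differences of \<open>\<Phi>\<close> along vertical segments matter.  On the left they vanish in the limit; on the right they
  approach \<open>\<i> a (\<beta>\<^sub>j - \<beta>\<^sub>0)\<close>, and summing them gives \<open>2 pi \<i> a / (q - 1)\<close>, a positive multiple of
  \<open>- a cis (pi / m)\<close>.
\<close>

lemma rotated_strip_sum:
  fixes p :: "complex \<Rightarrow> complex"
  assumes hol: "p holomorphic_on {z. \<bar>Im z\<bar> < pi}"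
    and m: "2 \<le> m"
    and b: "b < pi" and \<beta>: "- b \<le> \<beta>" "\<beta> + 2 * pi * (real m - 1) / real m \<le> b"
    and top: "\<And>e. 0 < e \<Longrightarrow> \<exists>T. \<forall>z. T \<le> Re z \<longrightarrow> \<bar>Im z\<bar> \<le> b \<longrightarrow> norm (p z - a) \<le> e"
    and bot: "\<And>e. 0 < e \<Longrightarrow> \<exists>T. \<forall>z. Re z \<le> T \<longrightarrow> \<bar>Im z\<bar> \<le> b \<longrightarrow> norm (p z) \<le> e"
    and pos: "\<And>t::real. 0 \<le> Re (\<gamma> * (\<Sum>j<m. cis (- (2 * pi * real j / real m)) *
                 p (of_real t + \<i> * of_real (\<beta> + 2 * pi * real j / real m))))"
  shows "Re (\<gamma> * a * cis (pi / real m)) \<le> 0"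
proof -
  define q where "q = cis (- (2 * pi / real m))"
  define \<beta>' where "\<beta>' j = \<beta> + 2 * pi * real j / real m" for j
  define pt where "pt t j = of_real t + \<i> * of_real (\<beta>' j)" for t :: real and j
  have qpow: "q ^ j = cis (- (2 * pi * real j / real m))" for j
    by (simp add: q_def Complex.DeMoivre field_simps)
  have q1: "q ^ m = 1"
    using m by (simp add: qpow cis.ctr complex_eq_iff)
  have s: "0 < sin (pi / real m)"
    using m by (intro sin_gt_zero) (auto simp: field_simps)
  have qm1: "q - 1 = - 2 * \<i> * sin (pi / real m) * cis (- (pi / real m))"
    using cis_minus_one_half_angle[of "pi / real m"] by (simp add: q_def)
  then have q2: "q \<noteq> 1"
    using s by auto
  have sumq: "(\<Sum>j<m. q ^ j) = 0"
    using geometric_sum[OF q2, of m] q1 by simp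
  have \<beta>'_bd: "\<bar>\<beta>' j\<bar> \<le> b" if "j < m" for j
  proof -
    have "2 * pi * real j / real m \<le> 2 * pi * (real m - 1) / real m"
      using that by (intro divide_right_mono mult_left_mono) auto
    moreover have "0 \<le> 2 * pi * real j / real m" by simp
    ultimately show ?thesis using \<beta> unfolding \<beta>'_def by linarith
  qed
  have opn: "open {z. \<bar>Im z\<bar> < pi}"
    by (intro open_Collect_less continuous_intros)
  have "{z. \<bar>Im z\<bar> < pi} = {z. Im z < pi} \<inter> {z. Im z > - pi}"
    by auto
  then have "convex {z. \<bar>Im z\<bar> < pi}"
    using convex_halfspace_Im_lt convex_halfspace_Im_gt by (metis convex_Int)
  then obtain \<Phi> where "\<And>z. z \<in> {z. \<bar>Im z\<bar> < pi} \<Longrightarrow>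
      (\<Phi> has_field_derivative p z) (at z within {z. \<bar>Im z\<bar> < pi})"
    using holomorphic_convex_primitive'[OF _ opn hol] by blast
  then have \<Phi>: "(\<Phi> has_field_derivative p z) (at z)" if "\<bar>Im z\<bar> < pi" for z
    using that at_within_open[OF _ opn] by force
  define S where "S t = Re (\<gamma> * (\<Sum>j<m. q ^ j * \<Phi> (pt t j)))" for t
  have S_mono: "S t1 \<le> S t2" if "t1 \<le> t2" for t1 t2
  proof (rule DERIV_nonneg_imp_nondecreasing[OF that])
    fix t
    have 1: "((\<lambda>t. \<Phi> (pt t j)) has_vector_derivative p (pt t j)) (at t)" if "j < m" for j
    proof -
      have "\<bar>Im (pt t j)\<bar> < pi"
        using \<beta>'_bd[OF that] b by (simp add: pt_def)
      then have "((\<lambda>z. \<Phi> (z + \<i> * of_real (\<beta>' j))) has_field_derivative p (pt t j)) (at (of_real t))"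
        using \<Phi>[of "pt t j"] unfolding pt_def by (intro iffD1[OF DERIV_shift])
      from has_vector_derivative_real_field[OF this] show ?thesis
        by (simp add: pt_def)
    qed
    have "((\<lambda>t. \<gamma> * (\<Sum>j<m. q ^ j * \<Phi> (pt t j))) has_vector_derivative
            (\<gamma> * (\<Sum>j<m. q ^ j * p (pt t j)))) (at t)"
      by (intro has_vector_derivative_mult_right has_vector_derivative_sum 1) auto
    from bounded_linear.has_vector_derivative[OF bounded_linear_Re this]
    have "(S has_real_derivative Re (\<gamma> * (\<Sum>j<m. q ^ j * p (pt t j)))) (at t)"
      unfolding has_real_derivative_iff_has_vector_derivative S_def .
    moreover have "0 \<le> Re (\<gamma> * (\<Sum>j<m. q ^ j * p (pt t j)))"
      using pos[of t] by (simp add: qpow pt_def \<beta>'_def)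
    ultimately show "\<exists>y. (S has_real_derivative y) (at t) \<and> 0 \<le> y"
      by (intro exI conjI)
  qed
  define L where "L = 2 * pi * \<i> / (q - 1)"
  \<comment> \<open>Used with \<open>k = a\<close> at the right end and with \<open>k = 0\<close> at the left end.\<close>
  have S_near: "\<bar>S t - Re (\<gamma> * k * L)\<bar> \<le> norm \<gamma> * real m * (2 * pi) * e"
    if e: "\<And>z. Re z = t \<Longrightarrow> \<bar>Im z\<bar> \<le> b \<Longrightarrow> norm (p z - k) \<le> e" for t k e
  proof -
    define d where "d j = (\<Phi> (pt t j) - k * pt t j) - (\<Phi> (pt t 0) - k * pt t 0)" for j
    have e0: "0 \<le> e"
      by (rule order_trans[OF norm_ge_zero e[of "pt t 0"]])
        (use \<beta>'_bd[of 0] m in \<open>simp_all add: pt_def\<close>)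
    have d: "norm (d j) \<le> e * (2 * pi)" if "j < m" for j
    proof -
      have "{z. Re z = t \<and> \<bar>Im z\<bar> \<le> b} = ({z. Re z \<le> t} \<inter> {z. Re z \<ge> t}) \<inter> ({z. Im z \<le> b} \<inter> {z. Im z \<ge> - b})"
        by auto
      then have "convex {z. Re z = t \<and> \<bar>Im z\<bar> \<le> b}"
        by (simp only:) (intro convex_Int convex_halfspace_Re_le convex_halfspace_Re_ge
          convex_halfspace_Im_le convex_halfspace_Im_ge)
      then have "norm (d j) \<le> e * norm (pt t j - pt t 0)"
        unfolding d_def
      proof (rule field_differentiable_bound[where f' = "\<lambda>z. p z - k"])
        fix z assume z: "z \<in> {z. Re z = t \<and> \<bar>Im z\<bar> \<le> b}"
        then show "((\<lambda>z. \<Phi> z - k * z) has_field_derivative p z - k)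
            (at z within {z. Re z = t \<and> \<bar>Im z\<bar> \<le> b})"
          using b by (auto intro!: derivative_eq_intros DERIV_subset[OF \<Phi>])
        show "norm (p z - k) \<le> e" using z e by auto
      qed (use that m \<beta>'_bd in \<open>auto simp: pt_def\<close>)
      also have "pt t j - pt t 0 = \<i> * of_real (2 * pi * real j / real m)"
        by (simp add: pt_def \<beta>'_def algebra_simps)
      also have "norm (\<i> * of_real (2 * pi * real j / real m)) = 2 * pi * (real j / real m)"
        by (simp only: norm_mult norm_ii norm_of_real) simp
      also have "e * (2 * pi * (real j / real m)) \<le> e * (2 * pi * 1)"
        using that e0 by (intro mult_left_mono) (auto simp: field_simps)
      finally show ?thesis by simp
    qed
    have "(\<Sum>j<m. q ^ j * \<Phi> (pt t j)) = (\<Sum>j<m. q ^ j * d j) + (\<Sum>j<m. q ^ j * (k * (pt t j - pt t 0)))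
        + (\<Sum>j<m. q ^ j) * \<Phi> (pt t 0)"
      unfolding sum_distrib_right sum.distrib[symmetric]
      by (intro sum.cong) (simp_all add: d_def algebra_simps)
    also have "(\<Sum>j<m. q ^ j * (k * (pt t j - pt t 0))) =
        k * (2 * pi * \<i> / of_nat m) * (\<Sum>j<m. of_nat j * q ^ j)"
      unfolding sum_distrib_left
      by (intro sum.cong) (simp_all add: pt_def \<beta>'_def algebra_simps)
    also have "\<dots> = k * L"
      using m q2 by (simp add: sum_index_mult_root_of_unity[OF q1 q2] L_def)
    finally have "S t - Re (\<gamma> * k * L) = Re (\<gamma> * (\<Sum>j<m. q ^ j * d j))"
      by (simp add: S_def sumq algebra_simps)
    also have "\<bar>\<dots>\<bar> \<le> norm \<gamma> * norm (\<Sum>j<m. q ^ j * d j)"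
      using abs_Re_le_cmod norm_mult by metis
    also have "\<dots> \<le> norm \<gamma> * (\<Sum>j<m. e * (2 * pi))"
      using d by (intro mult_left_mono sum_norm_le) (simp_all add: norm_mult qpow)
    finally show ?thesis
      by (simp add: mult.assoc mult.left_commute mult.commute[of e])
  qed
  have Re_scale: "Re (of_real r * z) = r * Re z" for r z
    by simp
  have "0 \<le> Re (\<gamma> * a * L)"
  proof (rule field_le_epsilon)
    fix \<epsilon> :: real assume "0 < \<epsilon>"
    define C where "C = norm \<gamma> * real m * (2 * pi)"
    \<comment> \<open>Each end contributes an error of at most \<open>C * e\<close>.\<close>
    define e where "e = \<epsilon> / (2 * (C + 1))"
    have C: "0 \<le> C" by (simp add: C_def)
    then have e: "0 < e" using \<open>0 < \<epsilon>\<close> by (simp add: e_def)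
    obtain T1 where T1: "\<And>z. T1 \<le> Re z \<Longrightarrow> \<bar>Im z\<bar> \<le> b \<Longrightarrow> norm (p z - a) \<le> e"
      using top[OF e] by blast
    obtain T2 where T2: "\<And>z. Re z \<le> T2 \<Longrightarrow> \<bar>Im z\<bar> \<le> b \<Longrightarrow> norm (p z) \<le> e"
      using bot[OF e] by blast
    have "\<bar>S (max T1 T2) - Re (\<gamma> * a * L)\<bar> \<le> C * e"
      unfolding C_def by (rule S_near) (auto intro: T1)
    moreover have "\<bar>S T2 - Re (\<gamma> * 0 * L)\<bar> \<le> C * e"
      unfolding C_def by (rule S_near) (auto intro: T2)
    moreover have "S T2 \<le> S (max T1 T2)"
      by (rule S_mono) simp
    moreover have "2 * (C * e) \<le> \<epsilon>"
      using C \<open>0 < \<epsilon>\<close> by (simp add: e_def field_simps)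
    ultimately show "0 \<le> Re (\<gamma> * a * L) + \<epsilon>" by simp
  qed
  also have "L = of_real (- pi / sin (pi / real m)) * cis (pi / real m)"
    using s unfolding L_def qm1 by (simp add: field_simps cis_mult)
  also have "\<gamma> * a * (of_real (- pi / sin (pi / real m)) * cis (pi / real m)) =
      of_real (- pi / sin (pi / real m)) * (\<gamma> * a * cis (pi / real m))"
    by (simp only: mult.left_commute mult.assoc)
  also have "Re \<dots> = (- pi / sin (pi / real m)) * Re (\<gamma> * a * cis (pi / real m))"
    by (rule Re_scale)
  finally show ?thesis
    using s by (meson divide_neg_pos mult_neg_pos neg_less_0_iff_less not_less pi_gt_zero)
qed

section \<open>Geometry of Hilbert spaces\<close>

lemma ring_of_type_algebra_simps [simp]:
  "carrier (ring_of_type_algebra :: 'a :: ring_1 ring) = UNIV"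
  "x \<otimes>\<^bsub>ring_of_type_algebra\<^esub> y = x * (y :: 'a)"
  "x \<oplus>\<^bsub>ring_of_type_algebra\<^esub> y = x + (y :: 'a)"
  "\<one>\<^bsub>ring_of_type_algebra\<^esub> = (1 :: 'a)"
  "\<zero>\<^bsub>ring_of_type_algebra\<^esub> = (0 :: 'a)"
  by (simp_all add: ring_of_type_algebra_def)

context complex_hilbert_space
begin

lemma smult_in_carrier [simp]: "x \<in> carrier H \<Longrightarrow> c \<odot> x \<in> carrier H"
  by (rule smult_closed) simp_all

lemma cinner_add_right:
  assumes "x \<in> carrier H" "y \<in> carrier H" "z \<in> carrier H"
  shows "cinner H x (y \<oplus> z) = cinner H x y + cinner H x z"
  using assms cinner_cnj[of "y \<oplus> z" x] cinner_cnj[of y x] cinner_cnj[of z x]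
  by (simp add: cinner_add_left)

lemma cinner_smult_right:
  assumes "x \<in> carrier H" "y \<in> carrier H"
  shows "cinner H x (c \<odot> y) = cnj c * cinner H x y"
  using assms cinner_cnj[of "c \<odot> y" x] cinner_cnj[of y x] by (simp add: cinner_smult_left)

lemma cinner_zero_left [simp]: "x \<in> carrier H \<Longrightarrow> cinner H \<zero> x = 0"
  using cinner_add_left[of \<zero> \<zero> x] by simp

lemma cinner_zero_right [simp]: "x \<in> carrier H \<Longrightarrow> cinner H x \<zero> = 0"
  using cinner_add_right[of x \<zero> \<zero>] by simp

lemma cinner_minus_left:
  assumes "x \<in> carrier H" "y \<in> carrier H"
  shows "cinner H (\<ominus> x) y = - cinner H x y"
proof -
  have "cinner H (\<ominus> x \<oplus> x) y = 0"
    using assms by (simp add: l_neg)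
  then show ?thesis
    using assms cinner_add_left[of "\<ominus> x" x y] by (simp add: eq_neg_iff_add_eq_0)
qed

lemma cinner_minus_right:
  assumes "x \<in> carrier H" "y \<in> carrier H"
  shows "cinner H x (\<ominus> y) = - cinner H x y"
  using assms cinner_cnj[of "\<ominus> y" x] cinner_cnj[of y x] by (simp add: cinner_minus_left)

lemma cinner_diff_left:
  "x \<in> carrier H \<Longrightarrow> y \<in> carrier H \<Longrightarrow> z \<in> carrier H \<Longrightarrow>
    cinner H (x \<ominus> y) z = cinner H x z - cinner H y z"
  by (simp add: a_minus_def cinner_add_left cinner_minus_left)

lemma cinner_diff_right:
  "x \<in> carrier H \<Longrightarrow> y \<in> carrier H \<Longrightarrow> z \<in> carrier H \<Longrightarrow>
    cinner H x (y \<ominus> z) = cinner H x y - cinner H x z"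
  by (simp add: a_minus_def cinner_add_right cinner_minus_right)

lemmas cinner_simps =
  cinner_add_left cinner_add_right cinner_smult_left cinner_smult_right
  cinner_diff_left cinner_diff_right

lemma diff_eq_zero_iff:
  assumes "x \<in> carrier H" "y \<in> carrier H"
  shows "x \<ominus> y = \<zero> \<longleftrightarrow> x = y"
proof
  assume "x \<ominus> y = \<zero>"
  then have "\<ominus> (\<ominus> y) = x"
    using assms by (intro M.minus_equality) (auto simp: a_minus_def)
  then show "x = y" using assms by simp
qed (use assms in \<open>simp add: a_minus_def M.r_neg\<close>)

text \<open>
  Identities between vectors reduce to identities between complex numbers by testing against all
  vectors; this replaces calculations with the module axioms.
\<close>

lemma vector_eqI:
  assumes "x \<in> carrier H" "y \<in> carrier H"
    and "\<And>z. z \<in> carrier H \<Longrightarrow> cinner H x z = cinner H y z"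
  shows "x = y"
proof -
  have "cinner H (x \<ominus> y) (x \<ominus> y) = 0"
    using assms by (simp add: cinner_diff_left)
  then show ?thesis
    using assms cinner_self_eq_0[of "x \<ominus> y"] by (simp add: diff_eq_zero_iff)
qed

lemma zero_smult: "x \<in> carrier H \<Longrightarrow> 0 \<odot> x = \<zero>"
  by (rule vector_eqI) (auto simp: cinner_simps)

lemma hnorm_nonneg [simp]: "x \<in> carrier H \<Longrightarrow> 0 \<le> hnorm H x"
  using cinner_self_nonneg[of x] by (auto simp: hnorm_def nonneg_Reals_def)

lemma cinner_self:
  assumes "x \<in> carrier H"
  shows "cinner H x x = of_real ((hnorm H x)\<^sup>2)"
  using cinner_self_nonneg[OF assms] by (auto simp: hnorm_def complex_nonneg_Reals_iff complex_eq_iff)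

lemma hnorm_power2: "x \<in> carrier H \<Longrightarrow> (hnorm H x)\<^sup>2 = Re (cinner H x x)"
  by (simp add: cinner_self)

lemma hnorm_eq_0: "x \<in> carrier H \<Longrightarrow> hnorm H x = 0 \<Longrightarrow> x = \<zero>"
  using cinner_self[of x] cinner_self_eq_0[of x] by simp

lemma hnorm_zero [simp]: "hnorm H \<zero> = 0"
  by (simp add: hnorm_def)

lemma hnorm_smult:
  assumes "x \<in> carrier H"
  shows "hnorm H (c \<odot> x) = cmod c * hnorm H x"
proof -
  have "cinner H (c \<odot> x) (c \<odot> x) = of_real ((cmod c)\<^sup>2 * (hnorm H x)\<^sup>2)"
    using assms complex_norm_square[of c]
    by (simp add: cinner_simps cinner_self[OF assms] mult.assoc[symmetric])
  then have "hnorm H (c \<odot> x) = sqrt ((cmod c)\<^sup>2 * (hnorm H x)\<^sup>2)"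
    by (simp only: hnorm_def Re_complex_of_real)
  then show ?thesis
    using assms by (simp add: real_sqrt_mult)
qed

text \<open>
  Expand the square of the norm of \<open>\<parallel>y\<parallel>\<^sup>2 x - \<langle>x, y\<rangle> y\<close>.
\<close>

lemma Cauchy_Schwarz:
  assumes "x \<in> carrier H" "y \<in> carrier H"
  shows "cmod (cinner H x y) \<le> hnorm H x * hnorm H y"
proof (cases "hnorm H y = 0")
  case True
  then have "y = \<zero>" by (rule hnorm_eq_0[OF assms(2)])
  then show ?thesis using assms by simp
next
  case False
  define a where "a = cinner H x y"
  define s where "s = complex_of_real ((hnorm H y)\<^sup>2)"
  have "cinner H y x = cnj a"
    unfolding a_def by (rule cinner_cnj[OF assms])
  then have "cinner H (s \<odot> x \<ominus> a \<odot> y) (s \<odot> x \<ominus> a \<odot> y)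
      = s * (s * cinner H x x - a * cnj a)"
    using assms by (simp add: cinner_simps a_def[symmetric] cinner_self[of y] s_def[symmetric])
      (simp add: s_def algebra_simps)
  also have "\<dots> = of_real ((hnorm H y)\<^sup>2 * ((hnorm H y)\<^sup>2 * (hnorm H x)\<^sup>2 - (cmod a)\<^sup>2))"
    using complex_norm_square[of a] by (simp add: s_def cinner_self[OF assms(1)])
  finally have "0 \<le> (hnorm H y)\<^sup>2 * ((hnorm H y)\<^sup>2 * (hnorm H x)\<^sup>2 - (cmod a)\<^sup>2)"
    using cinner_self_nonneg[of "s \<odot> x \<ominus> a \<odot> y"] assms
    by (simp only: nonneg_Reals_of_real_iff smult_in_carrier M.minus_closed)
  moreover have "0 < (hnorm H y)\<^sup>2"
    using False by simp
  ultimately have "0 \<le> (hnorm H y)\<^sup>2 * (hnorm H x)\<^sup>2 - (cmod a)\<^sup>2"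
    by (meson mult_pos_neg not_less)
  then have "(cmod a)\<^sup>2 \<le> (hnorm H x * hnorm H y)\<^sup>2"
    by (simp add: power_mult_distrib mult.commute)
  then show ?thesis
    unfolding a_def by (rule power2_le_imp_le) (simp add: assms)
qed

lemma hnorm_add_power2:
  assumes "x \<in> carrier H" "y \<in> carrier H"
  shows "(hnorm H (x \<oplus> y))\<^sup>2 = (hnorm H x)\<^sup>2 + (hnorm H y)\<^sup>2 + 2 * Re (cinner H x y)"
  using assms cinner_cnj[OF assms] by (simp add: hnorm_power2 cinner_simps)

lemma hnorm_triangle:
  assumes "x \<in> carrier H" "y \<in> carrier H"
  shows "hnorm H (x \<oplus> y) \<le> hnorm H x + hnorm H y"
proof (rule power2_le_imp_le)
  have "Re (cinner H x y) \<le> hnorm H x * hnorm H y"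
    by (rule order_trans[OF complex_Re_le_cmod Cauchy_Schwarz[OF assms]])
  then show "(hnorm H (x \<oplus> y))\<^sup>2 \<le> (hnorm H x + hnorm H y)\<^sup>2"
    unfolding hnorm_add_power2[OF assms] power2_sum by simp
  show "0 \<le> hnorm H x + hnorm H y"
    using assms by (intro add_nonneg_nonneg hnorm_nonneg)
qed

lemma hnorm_minus:
  assumes "x \<in> carrier H"
  shows "hnorm H (\<ominus> x) = hnorm H x"
  using assms by (simp add: hnorm_def cinner_minus_left cinner_minus_right)

lemma hnorm_triangle_diff:
  assumes "x \<in> carrier H" "y \<in> carrier H"
  shows "hnorm H (x \<ominus> y) \<le> hnorm H x + hnorm H y"
  using assms hnorm_triangle[of x "\<ominus> y"] by (simp add: a_minus_def hnorm_minus)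

lemma hnorm_diff_commute:
  assumes "x \<in> carrier H" "y \<in> carrier H"
  shows "hnorm H (x \<ominus> y) = hnorm H (y \<ominus> x)"
  using assms by (simp add: hnorm_def cinner_simps algebra_simps)

lemma Cauchy_imp_convergent:
  assumes s: "\<And>i. s i \<in> carrier H"
    and Cauchy: "\<And>e. 0 < e \<Longrightarrow> \<exists>N::nat. \<forall>i\<ge>N. \<forall>j\<ge>N. hnorm H (s i \<ominus> s j) < e"
  obtains z where "z \<in> carrier H" and "(\<lambda>i. hnorm H (s i \<ominus> z)) \<longlonglongrightarrow> 0"
proof -
  interpret MS: Metric_space "carrier H" "hdist H"
  proof
    show "0 \<le> hdist H x y" for x y
      by (simp add: hdist_def)
    show "hdist H x y = hdist H y x" for x y
      using hnorm_diff_commute by (simp add: hdist_def)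
    show "hdist H x y = 0 \<longleftrightarrow> x = y" if "x \<in> carrier H" "y \<in> carrier H" for x y
      using that hnorm_eq_0[of "x \<ominus> y"] diff_eq_zero_iff[of x y] by (auto simp: hdist_def)
    show "hdist H x z \<le> hdist H x y + hdist H y z"
      if "x \<in> carrier H" "y \<in> carrier H" "z \<in> carrier H" for x y z
    proof -
      have "x \<ominus> z = (x \<ominus> y) \<oplus> (y \<ominus> z)"
        using that by (intro vector_eqI) (auto simp: cinner_simps)
      then show ?thesis
        using that hnorm_triangle[of "x \<ominus> y" "y \<ominus> z"] by (simp add: hdist_def)
    qed
  qed
  have "MS.MCauchy s"
    unfolding MS.MCauchy_def using s Cauchy by (simp add: hdist_def image_subset_iff)
  then obtain z where "limitin MS.mtopology s z sequentially"
    using complete unfolding MS.mcomplete_def by blast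
  then have z: "z \<in> carrier H" and "\<And>e. 0 < e \<Longrightarrow> \<exists>N. \<forall>i\<ge>N. hnorm H (s i \<ominus> z) < e"
    using s unfolding MS.limit_metric_sequentially by (auto simp: hdist_def)
  then have "(\<lambda>i. hnorm H (s i \<ominus> z)) \<longlonglongrightarrow> 0"
    using s by (intro LIMSEQ_I) auto
  with z that show ?thesis by blast
qed

section \<open>Bounded operators\<close>

lemma bounded_operatorI:
  assumes "\<And>x. x \<in> carrier H \<Longrightarrow> B x \<in> carrier H"
    and "\<And>x y. x \<in> carrier H \<Longrightarrow> y \<in> carrier H \<Longrightarrow> B (x \<oplus> y) = B x \<oplus> B y"
    and "\<And>c x. x \<in> carrier H \<Longrightarrow> B (c \<odot> x) = c \<odot> B x"
    and "\<And>x. x \<in> carrier H \<Longrightarrow> hnorm H (B x) \<le> K * hnorm H x"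
  shows "bounded_operator H B"
  unfolding bounded_operator_def by (intro conjI exI[of _ K]) (use assms in \<open>simp_all add: Pi_iff\<close>)

context
  fixes B assumes B: "bounded_operator H B"
begin

lemma bounded_operator_closed: "x \<in> carrier H \<Longrightarrow> B x \<in> carrier H"
  using B by (simp add: bounded_operator_def Pi_iff)

lemma bounded_operator_add: "x \<in> carrier H \<Longrightarrow> y \<in> carrier H \<Longrightarrow> B (x \<oplus> y) = B x \<oplus> B y"
  using B by (simp add: bounded_operator_def Pi_iff)

lemma bounded_operator_smult: "x \<in> carrier H \<Longrightarrow> B (c \<odot> x) = c \<odot> B x"
  using B by (simp add: bounded_operator_def Pi_iff)

lemma bounded_operator_diff:
  assumes [simp]: "x \<in> carrier H" "y \<in> carrier H"
  shows "B (x \<ominus> y) = B x \<ominus> B y"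
proof -
  have "x \<ominus> y = x \<oplus> (- 1) \<odot> y"
    using assms by (intro vector_eqI) (auto simp: cinner_simps)
  then have "B (x \<ominus> y) = B x \<oplus> (- 1) \<odot> B y"
    by (simp add: bounded_operator_closed bounded_operator_add bounded_operator_smult)
  also have "\<dots> = B x \<ominus> B y"
    by (intro vector_eqI) (auto simp: bounded_operator_closed cinner_simps)
  finally show ?thesis .
qed

lemma bounded_operator_zero: "B \<zero> = \<zero>"
proof -
  have "B (0 \<odot> \<zero>) = 0 \<odot> B \<zero>"
    by (rule bounded_operator_smult) simp
  then show ?thesis by (simp add: zero_smult bounded_operator_closed)
qed

lemma bounded_operator_bound: "\<exists>K\<ge>1. \<forall>x\<in>carrier H. hnorm H (B x) \<le> K * hnorm H x"
proof -
  have "\<exists>K. \<forall>x\<in>carrier H. hnorm H (B x) \<le> K * hnorm H x"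
    using B by (simp add: bounded_operator_def)
  then obtain K where K: "\<forall>x\<in>carrier H. hnorm H (B x) \<le> K * hnorm H x" ..
  have "hnorm H (B x) \<le> max 1 K * hnorm H x" if "x \<in> carrier H" for x
    by (rule order_trans[OF bspec[OF K that] mult_right_mono]) (use that in auto)
  then show ?thesis
    by (intro exI[of _ "max 1 K"]) auto
qed

end

lemmas bounded_operator_simps =
  bounded_operator_closed bounded_operator_add bounded_operator_smult
  bounded_operator_diff bounded_operator_zero

lemma bounded_operator_id: "bounded_operator H (\<lambda>x. x)"
  by (rule bounded_operatorI[where K = 1]) auto

lemma bounded_operator_compose:
  assumes A: "bounded_operator H A" and B: "bounded_operator H B"
  shows "bounded_operator H (\<lambda>x. A (B x))"
proof -
  obtain K where K: "1 \<le> K" "\<And>x. x \<in> carrier H \<Longrightarrow> hnorm H (A x) \<le> K * hnorm H x"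
    using bounded_operator_bound[OF A] by metis
  obtain L where L: "1 \<le> L" "\<And>x. x \<in> carrier H \<Longrightarrow> hnorm H (B x) \<le> L * hnorm H x"
    using bounded_operator_bound[OF B] by metis
  show ?thesis
  proof (rule bounded_operatorI[where K = "K * L"])
    fix x assume x: "x \<in> carrier H"
    have "hnorm H (A (B x)) \<le> K * hnorm H (B x)"
      using K(2) x by (simp add: bounded_operator_simps[OF B])
    also have "\<dots> \<le> K * (L * hnorm H x)"
      using K L x by (intro mult_left_mono) auto
    finally show "hnorm H (A (B x)) \<le> K * L * hnorm H x"
      by (simp add: algebra_simps)
  qed (use A B in \<open>simp_all add: bounded_operator_simps[OF A] bounded_operator_simps[OF B]\<close>)
qed

lemma bounded_operator_add_smult:
  assumes A: "bounded_operator H A" and B: "bounded_operator H B"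
  shows "bounded_operator H (\<lambda>x. A x \<oplus> c \<odot> B x)"
proof -
  obtain K where K: "1 \<le> K" "\<And>x. x \<in> carrier H \<Longrightarrow> hnorm H (A x) \<le> K * hnorm H x"
    using bounded_operator_bound[OF A] by metis
  obtain L where L: "1 \<le> L" "\<And>x. x \<in> carrier H \<Longrightarrow> hnorm H (B x) \<le> L * hnorm H x"
    using bounded_operator_bound[OF B] by metis
  note AB = bounded_operator_simps[OF A] bounded_operator_simps[OF B]
  show ?thesis
  proof (rule bounded_operatorI[where K = "K + cmod c * L"])
    fix x assume x: "x \<in> carrier H"
    have "hnorm H (A x \<oplus> c \<odot> B x) \<le> hnorm H (A x) + cmod c * hnorm H (B x)"
      using x hnorm_triangle[of "A x" "c \<odot> B x"] by (simp add: AB hnorm_smult)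
    also have "\<dots> \<le> K * hnorm H x + cmod c * (L * hnorm H x)"
      using K L x by (intro add_mono mult_left_mono) auto
    finally show "hnorm H (A x \<oplus> c \<odot> B x) \<le> (K + cmod c * L) * hnorm H x"
      by (simp add: algebra_simps)
  qed (auto simp: AB cinner_simps algebra_simps intro!: vector_eqI)
qed

lemma bounded_operator_power: "bounded_operator H A \<Longrightarrow> bounded_operator H (A ^^ k)"
proof (induction k)
  case 0
  then show ?case by (simp add: id_def bounded_operator_id)
next
  case (Suc k)
  then show ?case
    using bounded_operator_compose[of A "A ^^ k"] by (simp add: comp_def)
qed

text \<open>
  The representing vector minimises \<open>\<parallel>D x\<parallel>\<^sup>2 - 2 Re (f x)\<close>: by the parallelogram identity and the lower
  bound on \<open>D\<close> every minimising sequence is Cauchy, and the first variation vanishes at the limit.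
  For the identity this is the Riesz representation theorem, and for \<open>f x = \<langle>D x, y\<rangle>\<close> it yields
  the orthogonal projection of \<open>y\<close> to the range of \<open>D\<close>.
\<close>

lemma variational_representation:
  assumes D: "bounded_operator H D"
    and c: "0 < c" "\<And>x. x \<in> carrier H \<Longrightarrow> c * hnorm H x \<le> hnorm H (D x)"
    and f_add: "\<And>x y. x \<in> carrier H \<Longrightarrow> y \<in> carrier H \<Longrightarrow> f (x \<oplus> y) = f x + f y"
    and f_smult: "\<And>a x. x \<in> carrier H \<Longrightarrow> f (a \<odot> x) = a * f x"
    and f_bound: "\<And>x. x \<in> carrier H \<Longrightarrow> cmod (f x) \<le> M * hnorm H x"
  obtains z where "z \<in> carrier H"
    and "\<And>x. x \<in> carrier H \<Longrightarrow> cinner H (D x) (D z) = f x"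
proof -
  note DS = bounded_operator_simps[OF D]
  define J where "J x = (hnorm H (D x))\<^sup>2 - 2 * Re (f x)" for x
  define I where "I = Inf (J ` carrier H)"
  have J_lower: "- (M\<^sup>2 / c\<^sup>2) \<le> J x" if x: "x \<in> carrier H" for x
  proof -
    have "Re (f x) \<le> M * hnorm H x"
      using f_bound[OF x] complex_Re_le_cmod order_trans by blast
    moreover have "(c * hnorm H x)\<^sup>2 \<le> (hnorm H (D x))\<^sup>2"
      using c x by (intro power_mono) auto
    moreover have "2 * (M * hnorm H x) \<le> (c * hnorm H x)\<^sup>2 + M\<^sup>2 / c\<^sup>2"
      using c(1) zero_le_power2[of "c * hnorm H x - M / c"]
      by (simp add: power2_diff power_divide mult.commute)
    ultimately show ?thesis
      unfolding J_def by linarith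
  qed
  then have bdd: "bdd_below (J ` carrier H)"
    by (intro bdd_belowI2)
  have I_le: "I \<le> J x" if "x \<in> carrier H" for x
    unfolding I_def using bdd that by (rule cINF_lower)
  have "\<exists>x\<in>carrier H. J x < I + 1 / real (Suc i)" for i
  proof -
    have "Inf (J ` carrier H) < I + 1 / real (Suc i)" by (simp add: I_def)
    then show ?thesis
      using bdd by (subst (asm) cInf_less_iff) auto
  qed
  then obtain s where s: "\<And>i. s i \<in> carrier H" "\<And>i. J (s i) < I + 1 / real (Suc i)"
    by metis
  \<comment> \<open>The increment of \<open>J\<close>: its linear part is the first variation.\<close>
  have expand: "J (x \<oplus> y) = J x + 2 * Re (cinner H (D y) (D x) - f y) + (hnorm H (D y))\<^sup>2"
    if "x \<in> carrier H" "y \<in> carrier H" for x y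
    using that cinner_cnj[of "D x" "D y"] by (simp add: J_def DS hnorm_add_power2 f_add)
  have dist: "(c * hnorm H (s i \<ominus> s j))\<^sup>2 \<le> 2 / real (Suc i) + 2 / real (Suc j)" for i j
  proof -
    let ?x = "s i" and ?y = "s j"
    have "(c * hnorm H (?x \<ominus> ?y))\<^sup>2 \<le> (hnorm H (D (?x \<ominus> ?y)))\<^sup>2"
      using c s(1) by (intro power_mono) auto
    also have "\<dots> = 2 * J ?x + 2 * J ?y - 4 * J ((1/2) \<odot> (?x \<oplus> ?y))"
      using s(1) by (simp add: J_def DS f_smult f_add hnorm_power2 cinner_simps algebra_simps)
    also have "\<dots> \<le> 2 / real (Suc i) + 2 / real (Suc j)"
    proof -
      have "I \<le> J ((1/2) \<odot> (?x \<oplus> ?y))"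
        using s(1) by (intro I_le) auto
      moreover have "2 / real (Suc l) = 2 * (1 / real (Suc l))" for l by simp
      ultimately show ?thesis
        using s(2)[of i] s(2)[of j] by linarith
    qed
    finally show ?thesis .
  qed
  obtain z where z: "z \<in> carrier H" and lim: "(\<lambda>i. hnorm H (s i \<ominus> z)) \<longlonglongrightarrow> 0"
  proof (rule Cauchy_imp_convergent[of s])
    fix e :: real assume "0 < e"
    then have "0 < (c * e)\<^sup>2 / 4" using c(1) by simp
    then obtain N where N: "1 / real (Suc N) < (c * e)\<^sup>2 / 4"
      using nat_approx_posE by metis
    have "hnorm H (s i \<ominus> s j) < e" if "N \<le> i" "N \<le> j" for i j
    proof -
      have "1 / real (Suc i) \<le> 1 / real (Suc N)" "1 / real (Suc j) \<le> 1 / real (Suc N)"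
        using that by (auto intro!: divide_left_mono)
      then have "(c * hnorm H (s i \<ominus> s j))\<^sup>2 < (c * e)\<^sup>2"
        using dist[of i j] N by simp
      then have "c * hnorm H (s i \<ominus> s j) < c * e"
        by (rule power2_less_imp_less) (simp add: c(1) \<open>0 < e\<close> less_imp_le)
      then show ?thesis using c(1) by simp
    qed
    then show "\<exists>N. \<forall>i\<ge>N. \<forall>j\<ge>N. hnorm H (s i \<ominus> s j) < e" by blast
  qed (use s in auto)
  define g where "g h = cinner H (D h) (D z) - f h" for h
  obtain K where "1 \<le> K" and K: "\<And>x. x \<in> carrier H \<Longrightarrow> hnorm H (D x) \<le> K * hnorm H x"
    using bounded_operator_bound[OF D] by metis
  have variation: "0 \<le> 2 * Re (g h) + (hnorm H (D h))\<^sup>2" if h: "h \<in> carrier H" for h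
  proof (rule LIMSEQ_le_const)
    have "(\<lambda>i. hnorm H (D h) * (K * hnorm H (s i \<ominus> z))) \<longlonglongrightarrow> hnorm H (D h) * (K * 0)"
      by (intro tendsto_intros lim)
    then have null: "(\<lambda>i. hnorm H (D h) * (K * hnorm H (s i \<ominus> z))) \<longlonglongrightarrow> 0"
      by (simp only: mult_zero_right)
    have diff: "norm (cinner H (D h) (D (s i)) - cinner H (D h) (D z))
        \<le> hnorm H (D h) * (K * hnorm H (s i \<ominus> z))" for i
    proof -
      have "norm (cinner H (D h) (D (s i)) - cinner H (D h) (D z)) = cmod (cinner H (D h) (D (s i \<ominus> z)))"
        using h z s(1) by (simp add: DS cinner_simps)
      also have "\<dots> \<le> hnorm H (D h) * hnorm H (D (s i \<ominus> z))"
        using h z s(1) by (intro Cauchy_Schwarz) (auto simp: DS)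
      also have "\<dots> \<le> hnorm H (D h) * (K * hnorm H (s i \<ominus> z))"
        using h z s(1) by (intro mult_left_mono K) (auto simp: DS)
      finally show ?thesis by simp
    qed
    have "(\<lambda>i. cinner H (D h) (D (s i)) - cinner H (D h) (D z)) \<longlonglongrightarrow> 0"
      by (rule Lim_null_comparison[OF _ null]) (rule always_eventually, rule allI, rule diff)
    then have "(\<lambda>i. cinner H (D h) (D (s i))) \<longlonglongrightarrow> cinner H (D h) (D z)"
      by (simp add: LIM_zero_iff)
    then have "(\<lambda>i. 1 / real (Suc i) + 2 * Re (cinner H (D h) (D (s i)) - f h) + (hnorm H (D h))\<^sup>2)
        \<longlonglongrightarrow> 0 + 2 * Re (g h) + (hnorm H (D h))\<^sup>2"
      unfolding g_def by (intro tendsto_intros LIMSEQ_Suc[OF lim_1_over_n])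
    then show "(\<lambda>i. 1 / real (Suc i) + 2 * Re (cinner H (D h) (D (s i)) - f h) + (hnorm H (D h))\<^sup>2)
        \<longlonglongrightarrow> 2 * Re (g h) + (hnorm H (D h))\<^sup>2"
      by simp
    have "0 \<le> 1 / real (Suc i) + 2 * Re (cinner H (D h) (D (s i)) - f h) + (hnorm H (D h))\<^sup>2" for i
      using expand[OF s(1) h, of i] I_le[of "s i \<oplus> h"] s(1)[of i] s(2)[of i] h by simp
    then show "\<exists>N. \<forall>i\<ge>N. 0 \<le> 1 / real (Suc i) + 2 * Re (cinner H (D h) (D (s i)) - f h) + (hnorm H (D h))\<^sup>2"
      by blast
  qed
  \<comment> \<open>A nonzero first variation could be made to beat the quadratic term by a short step against it.\<close>
  have "g x = 0" if x: "x \<in> carrier H" for x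
  proof (rule ccontr)
    assume g: "g x \<noteq> 0"
    define t where "t = 1 / (1 + (hnorm H (D x))\<^sup>2)"
    define h where "h = (- of_real t * cnj (g x)) \<odot> x"
    have h: "h \<in> carrier H" using x by (simp add: h_def)
    have d: "0 < 1 + (hnorm H (D x))\<^sup>2" by (simp add: add_pos_nonneg)
    then have t: "0 < t" by (simp add: t_def)
    have "g h = (- of_real t * cnj (g x)) * g x"
      using x z by (simp add: g_def h_def DS cinner_simps f_smult algebra_simps)
    also have "\<dots> = of_real (- t * (cmod (g x))\<^sup>2)"
      using complex_norm_square[of "g x"] by (simp add: mult.commute)
    finally have "Re (g h) = - t * (cmod (g x))\<^sup>2" by simp
    moreover have "hnorm H (D h) = t * cmod (g x) * hnorm H (D x)"
      using x t by (simp add: h_def DS hnorm_smult norm_mult)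
    ultimately have "0 \<le> t * (cmod (g x))\<^sup>2 * (t * (hnorm H (D x))\<^sup>2 - 2)"
      using variation[OF h] by (simp add: power2_eq_square algebra_simps)
    moreover have "t * (hnorm H (D x))\<^sup>2 - 2 < 0"
      using d by (simp add: t_def divide_less_eq)
    moreover have "0 < t * (cmod (g x))\<^sup>2"
      using t g by simp
    ultimately show False
      by (meson mult_pos_neg not_less)
  qed
  with z that show ?thesis by (simp add: g_def)
qed

lemma adjoint_operator:
  assumes B: "bounded_operator H B" and y: "y \<in> carrier H"
  shows adjoint_closed: "adjoint_operator H B y \<in> carrier H"
    and cinner_adjoint: "\<And>x. x \<in> carrier H \<Longrightarrow> cinner H (B x) y = cinner H x (adjoint_operator H B y)"
proof -
  note BS = bounded_operator_simps[OF B]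
  obtain K where K: "1 \<le> K" "\<And>x. x \<in> carrier H \<Longrightarrow> hnorm H (B x) \<le> K * hnorm H x"
    using bounded_operator_bound[OF B] by metis
  let ?P = "\<lambda>z. z \<in> carrier H \<and> (\<forall>x\<in>carrier H. cinner H (B x) y = cinner H x z)"
  obtain z where z: "z \<in> carrier H" "\<And>x. x \<in> carrier H \<Longrightarrow> cinner H x z = cinner H (B x) y"
  proof (rule variational_representation[OF bounded_operator_id, of 1 "\<lambda>x. cinner H (B x) y" "K * hnorm H y"])
    fix x assume x: "x \<in> carrier H"
    have "cmod (cinner H (B x) y) \<le> hnorm H (B x) * hnorm H y"
      by (rule Cauchy_Schwarz) (simp_all add: BS x y)
    also have "\<dots> \<le> K * hnorm H x * hnorm H y"
      by (intro mult_right_mono K x hnorm_nonneg y)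
    finally show "cmod (cinner H (B x) y) \<le> K * hnorm H y * hnorm H x"
      by (simp add: mult.commute mult.left_commute)
  qed (auto simp: BS y cinner_simps)
  have "?P (THE z. ?P z)"
  proof (rule theI[of ?P])
    show "?P z" using z by simp
    fix z' assume z': "?P z'"
    show "z' = z"
    proof (rule vector_eqI)
      fix x assume x: "x \<in> carrier H"
      have "cinner H x z' = cinner H x z"
        using z' z(2)[OF x] x by simp
      then show "cinner H z' x = cinner H z x"
        using cinner_cnj[of x z'] cinner_cnj[of x z] x z' z(1) by simp
    qed (use z' z in auto)
  qed
  then show "adjoint_operator H B y \<in> carrier H"
    and "\<And>x. x \<in> carrier H \<Longrightarrow> cinner H (B x) y = cinner H x (adjoint_operator H B y)"
    unfolding adjoint_operator_def by auto
qed

section \<open>Accretive operators and their powers\<close>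

definition accretive :: "('a \<Rightarrow> 'a) \<Rightarrow> bool" where
  "accretive B \<longleftrightarrow> (\<forall>x\<in>carrier H. 0 \<le> Re (cinner H (B x) x))"

lemma accretiveD: "accretive B \<Longrightarrow> x \<in> carrier H \<Longrightarrow> 0 \<le> Re (cinner H (B x) x)"
  by (simp add: accretive_def)

lemma positive_Re_operator_iff:
  assumes B: "bounded_operator H B"
  shows "positive_operator H (Re_operator H B) \<longleftrightarrow> accretive B"
proof -
  have "cinner H (Re_operator H B x) x = of_real (Re (cinner H (B x) x))" if x: "x \<in> carrier H" for x
  proof -
    have "cinner H (adjoint_operator H B x) x = cnj (cinner H (B x) x)"
      using cinner_cnj[OF x adjoint_closed[OF B x]] cinner_adjoint[OF B x x] by simp
    then show ?thesis
      using x adjoint_closed[OF B x]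
      by (simp add: Re_operator_def cinner_simps bounded_operator_simps[OF B] complex_add_cnj)
  qed
  then show ?thesis
    unfolding positive_operator_def accretive_def
    by (simp only: nonneg_Reals_of_real_iff cong: ball_cong)
qed

lemma accretive_lower_bound:
  assumes B: "bounded_operator H B" "accretive B" and u: "u \<in> carrier H"
  shows "Re \<mu> * hnorm H u \<le> hnorm H (B u \<oplus> \<mu> \<odot> u)"
proof (cases "hnorm H u = 0")
  case True
  then show ?thesis using u by (simp add: bounded_operator_simps[OF B(1)])
next
  case False
  then have pos: "0 < hnorm H u"
    using hnorm_nonneg[OF u] by linarith
  note BS = bounded_operator_simps[OF B(1)]
  have "Re \<mu> * hnorm H u * hnorm H u \<le> Re (cinner H (B u \<oplus> \<mu> \<odot> u) u)"
    using accretiveD[OF B(2) u] u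
    by (simp add: cinner_simps BS cinner_self power2_eq_square flip: of_real_power of_real_mult)
  also have "\<dots> \<le> hnorm H (B u \<oplus> \<mu> \<odot> u) * hnorm H u"
    by (rule order_trans[OF complex_Re_le_cmod Cauchy_Schwarz]) (simp_all add: u BS)
  finally show ?thesis
    using pos by (rule mult_right_le_imp_le)
qed

text \<open>
  The range of \<open>D = B + \<mu>\<close> is closed because \<open>D\<close> is bounded below.  The residual \<open>r\<close> of the projection of
  \<open>x\<close> to this range is orthogonal to \<open>D r\<close>, so \<open>Re \<mu> \<parallel>r\<parallel>\<^sup>2 \<le> Re \<langle>D r, r\<rangle> = 0\<close>.
\<close>

lemma accretive_add_scalar_surj:
  assumes B: "bounded_operator H B" "accretive B" and \<mu>: "0 < Re \<mu>" and x: "x \<in> carrier H"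
  shows "\<exists>u\<in>carrier H. B u \<oplus> \<mu> \<odot> u = x"
proof -
  define D where "D u = B u \<oplus> \<mu> \<odot> u" for u
  have D: "bounded_operator H D"
    unfolding D_def using bounded_operator_add_smult[OF B(1) bounded_operator_id] .
  note DS = bounded_operator_simps[OF D]
  obtain K where K: "1 \<le> K" "\<And>x. x \<in> carrier H \<Longrightarrow> hnorm H (D x) \<le> K * hnorm H x"
    using bounded_operator_bound[OF D] by metis
  obtain z where z: "z \<in> carrier H" "\<And>h. h \<in> carrier H \<Longrightarrow> cinner H (D h) (D z) = cinner H (D h) x"
  proof (rule variational_representation[OF D \<mu>, of "\<lambda>h. cinner H (D h) x" "K * hnorm H x"])
    show "Re \<mu> * hnorm H u \<le> hnorm H (D u)" if "u \<in> carrier H" for u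
      unfolding D_def by (rule accretive_lower_bound[OF B that])
    fix h assume h: "h \<in> carrier H"
    have "cmod (cinner H (D h) x) \<le> hnorm H (D h) * hnorm H x"
      by (rule Cauchy_Schwarz) (simp_all add: DS h x)
    also have "\<dots> \<le> K * hnorm H h * hnorm H x"
      by (intro mult_right_mono K h hnorm_nonneg x)
    finally show "cmod (cinner H (D h) x) \<le> K * hnorm H x * hnorm H h"
      by (simp add: mult.commute mult.left_commute)
  qed (auto simp: DS x cinner_simps)
  define r where "r = x \<ominus> D z"
  have r: "r \<in> carrier H" using x z by (simp add: r_def DS)
  have "cinner H (D r) r = 0"
    using z(2)[OF r] x z(1) by (simp add: r_def[of] cinner_diff_right DS r[unfolded r_def])
  moreover have "Re (cinner H (D r) r) = Re (cinner H (B r) r) + Re \<mu> * (hnorm H r)\<^sup>2"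
    using r by (simp add: D_def cinner_simps bounded_operator_simps[OF B(1)] cinner_self flip: of_real_power)
  ultimately have "Re \<mu> * (hnorm H r)\<^sup>2 \<le> 0"
    using accretiveD[OF B(2) r] by simp
  then have "hnorm H r = 0"
    using \<mu> by (simp add: mult_le_0_iff)
  then have "r = \<zero>" using r by (intro hnorm_eq_0)
  then have "D z = x" using x z by (simp add: r_def diff_eq_zero_iff DS)
  then show ?thesis using z(1) by (auto simp: D_def)
qed

text \<open>
  The quotient \<open>(A\<^sup>i - w\<^sup>i) / (A - w) = \<Sum> w\<^bsup>i-1-j\<^esup> A\<^sup>j\<close> in Horner form, which avoids sums of vectors.
\<close>

primrec power_quotient :: "('a \<Rightarrow> 'a) \<Rightarrow> complex \<Rightarrow> nat \<Rightarrow> 'a \<Rightarrow> 'a" where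
  "power_quotient A w 0 y = \<zero>"
| "power_quotient A w (Suc i) y = A (power_quotient A w i y) \<oplus> w ^ i \<odot> y"

context
  fixes A assumes A: "bounded_operator H A"
begin

lemma power_closed: "x \<in> carrier H \<Longrightarrow> (A ^^ k) x \<in> carrier H"
  using bounded_operator_closed[OF bounded_operator_power[OF A]] .

lemma power_quotient_closed: "y \<in> carrier H \<Longrightarrow> power_quotient A w i y \<in> carrier H"
  by (induction i) (simp_all add: bounded_operator_simps[OF A])

lemma power_quotient_left:
  assumes "u \<in> carrier H"
  shows "power_quotient A w i (A u \<oplus> (- w) \<odot> u) = (A ^^ i) u \<oplus> (- (w ^ i)) \<odot> u"
proof (induction i)
  case 0
  then show ?case
    using assms by (intro vector_eqI) (auto simp: cinner_simps)
next
  case (Suc i)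
  show ?case
    unfolding power_quotient.simps Suc
    by (rule vector_eqI)
      (simp_all add: assms bounded_operator_simps[OF A] power_closed cinner_simps algebra_simps)
qed

lemma power_quotient_right:
  assumes "y \<in> carrier H"
  shows "A (power_quotient A w i y) \<oplus> (- w) \<odot> power_quotient A w i y
    = (A ^^ i) y \<oplus> (- (w ^ i)) \<odot> y"
proof (induction i)
  case 0
  show ?case
    using assms by (intro vector_eqI) (auto simp: cinner_simps bounded_operator_simps[OF A])
next
  case (Suc i)
  let ?q = "power_quotient A w i y"
  have q: "?q \<in> carrier H" using assms by (rule power_quotient_closed)
  have "A (A ?q) \<oplus> (- w) \<odot> A ?q = A (A ?q \<oplus> (- w) \<odot> ?q)"
    using q by (simp add: bounded_operator_simps[OF A])
  also have "\<dots> = A ((A ^^ i) y) \<oplus> (- (w ^ i)) \<odot> A y"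
    using assms by (simp add: Suc bounded_operator_simps[OF A] power_closed)
  finally have E: "A (A ?q) \<oplus> (- w) \<odot> A ?q = A ((A ^^ i) y) \<oplus> (- (w ^ i)) \<odot> A y" .
  show ?case
  proof (rule vector_eqI)
    fix z assume z: "z \<in> carrier H"
    have "cinner H (A (A ?q) \<oplus> (- w) \<odot> A ?q) z = cinner H (A ((A ^^ i) y) \<oplus> (- (w ^ i)) \<odot> A y) z"
      unfolding E ..
    then show "cinner H (A (power_quotient A w (Suc i) y) \<oplus> (- w) \<odot> power_quotient A w (Suc i) y) z
        = cinner H ((A ^^ Suc i) y \<oplus> (- (w ^ Suc i)) \<odot> y) z"
      using z assms q by (simp add: bounded_operator_simps[OF A] power_closed cinner_simps algebra_simps)
  qed (simp_all add: assms q bounded_operator_simps[OF A] power_closed)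
qed

lemma cinner_power_quotient:
  assumes "u \<in> carrier H" "x \<in> carrier H"
  shows "cinner H ((A ^^ l) (power_quotient A w i u)) x
    = (\<Sum>j<i. w ^ (i - 1 - j) * cinner H ((A ^^ (l + j)) u) x)"
proof (induction i arbitrary: l)
  case 0
  then show ?case
    using assms by (simp add: bounded_operator_zero[OF bounded_operator_power[OF A]])
next
  case (Suc i)
  note AlS = bounded_operator_simps[OF bounded_operator_power[OF A, of l]]
  have "cinner H ((A ^^ l) (power_quotient A w (Suc i) u)) x =
      cinner H ((A ^^ Suc l) (power_quotient A w i u)) x + w ^ i * cinner H ((A ^^ l) u) x"
    using assms by (simp add: AlS bounded_operator_simps[OF A] power_quotient_closed cinner_simps funpow_swap1)
  also have "\<dots> = (\<Sum>j<Suc i. w ^ (Suc i - 1 - j) * cinner H ((A ^^ (l + j)) u) x)"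
    unfolding Suc sum.lessThan_Suc_shift by simp
  finally show ?case .
qed

lemma hnorm_power_quotient_le:
  assumes K: "\<And>x. x \<in> carrier H \<Longrightarrow> hnorm H (A x) \<le> L * hnorm H x"
    and L: "1 \<le> L" "cmod w \<le> L" and y: "y \<in> carrier H"
  shows "hnorm H (power_quotient A w i y) \<le> real i * L ^ i * hnorm H y"
proof (induction i)
  case 0
  then show ?case by simp
next
  case (Suc i)
  let ?q = "power_quotient A w i y"
  have q: "?q \<in> carrier H" using y by (rule power_quotient_closed)
  have "hnorm H (power_quotient A w (Suc i) y) \<le> hnorm H (A ?q) + cmod w ^ i * hnorm H y"
    using hnorm_triangle[of "A ?q" "w ^ i \<odot> y"] q y
    by (simp add: bounded_operator_simps[OF A] hnorm_smult norm_power)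
  also have "\<dots> \<le> L * (real i * L ^ i * hnorm H y) + L ^ i * hnorm H y"
    using q y L by (intro add_mono mult_right_mono power_mono order_trans[OF K[OF q] mult_left_mono] Suc) auto
  also have "\<dots> \<le> L * (real i * L ^ i * hnorm H y) + (L * L ^ i) * hnorm H y"
    using L(1) y by (intro add_left_mono mult_right_mono) auto
  finally show ?case by (simp add: algebra_simps)
qed

text \<open>
  \<open>A\<^sup>m - w\<^sup>m\<close> is bounded below because \<open>A\<^sup>m\<close> is accretive; its factor \<open>A - w\<close> inherits this up to the norm
  of the other factor.
\<close>

lemma power_accretive_lower_bound:
  assumes L: "1 \<le> L" "\<And>x. x \<in> carrier H \<Longrightarrow> hnorm H (A x) \<le> L * hnorm H x" and w: "cmod w \<le> L"
    and acc: "accretive (A ^^ m)" and u: "u \<in> carrier H"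
  shows "- Re (w ^ m) * hnorm H u \<le> real m * L ^ m * hnorm H (A u \<oplus> (- w) \<odot> u)"
proof -
  have "Re (- (w ^ m)) * hnorm H u \<le> hnorm H ((A ^^ m) u \<oplus> (- (w ^ m)) \<odot> u)"
    by (rule accretive_lower_bound[OF bounded_operator_power[OF A] acc u])
  also have "\<dots> = hnorm H (power_quotient A w m (A u \<oplus> (- w) \<odot> u))"
    by (simp only: power_quotient_left[OF u])
  also have "\<dots> \<le> real m * L ^ m * hnorm H (A u \<oplus> (- w) \<odot> u)"
    using L(1) by (intro hnorm_power_quotient_le L w) (auto simp: u bounded_operator_simps[OF A])
  finally show ?thesis by simp
qed

lemma power_accretive_surj:
  assumes "accretive (A ^^ m)" and "Re (w ^ m) < 0" and x: "x \<in> carrier H"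
  shows "\<exists>u\<in>carrier H. A u \<oplus> (- w) \<odot> u = x"
proof -
  obtain u where u: "u \<in> carrier H" "(A ^^ m) u \<oplus> (- (w ^ m)) \<odot> u = x"
    using accretive_add_scalar_surj[OF bounded_operator_power[OF A] assms(1) _ x, of "- (w ^ m)"] assms(2)
    by auto
  then show ?thesis
    using power_quotient_right[OF u(1)] power_quotient_closed[OF u(1)] by metis
qed

end

end

section \<open>The resolvent on the slit plane\<close>

text \<open>
  The open sets on which one of the first functions is below a negative level exhaust \<open>S\<close>, so finitely
  many functions and one level suffice.
\<close>

lemma compact_uniformly_negative:
  fixes f :: "nat \<Rightarrow> 'a :: topological_space \<Rightarrow> real"
  assumes "compact S" and "\<And>k. continuous_on UNIV (f k)"
    and "\<And>w. w \<in> S \<Longrightarrow> \<exists>k. f k w < 0"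
  obtains K \<delta> where "0 < \<delta>" and "\<And>w. w \<in> S \<Longrightarrow> \<exists>k\<le>K. f k w \<le> - \<delta>"
proof -
  define U where "U l = (\<Union>k\<le>l. {w. f k w < - (1 / real (Suc l))})" for l
  have "open (U l)" for l
    unfolding U_def using assms(2) by (intro open_UN ballI open_Collect_less) auto
  moreover have "S \<subseteq> (\<Union>l. U l)"
  proof
    fix w assume "w \<in> S"
    then obtain k where k: "f k w < 0" using assms(3) by blast
    then obtain i where i: "1 / real (Suc i) < - f k w"
      using nat_approx_posE[of "- f k w"] by auto
    have "1 / real (Suc (max k i)) \<le> 1 / real (Suc i)"
      by (intro divide_left_mono) auto
    then have "w \<in> U (max k i)"
      using i unfolding U_def by (intro UN_I[of k]) auto
    then show "w \<in> (\<Union>l. U l)" by blast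
  qed
  ultimately obtain F where F: "finite F" "S \<subseteq> (\<Union>l\<in>F. U l)"
    using compactE_image[OF assms(1), of UNIV U] by auto
  define K where "K = Max (insert 0 F)"
  have "\<exists>k\<le>K. f k w \<le> - (1 / real (Suc K))" if "w \<in> S" for w
  proof -
    obtain l k where l: "l \<in> F" "k \<le> l" "f k w < - (1 / real (Suc l))"
      using F(2) \<open>w \<in> S\<close> unfolding U_def by blast
    have "l \<le> K" using l F by (simp add: K_def)
    moreover from this have "1 / real (Suc K) \<le> 1 / real (Suc l)"
      by (intro divide_left_mono) auto
    ultimately show ?thesis using l by (intro exI[of _ k]) auto
  qed
  then show ?thesis using that[of "1 / real (Suc K)" K] by simp
qed

text \<open>
  The exponential maps the strip into the plane slit along the negative axis, where the resolvent will
  be defined.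
\<close>

lemma exp_notin_nonpos_Reals:
  assumes "\<bar>Im z\<bar> < pi"
  shows "exp z \<notin> \<real>\<^sub>\<le>\<^sub>0"
proof
  assume "exp z \<in> \<real>\<^sub>\<le>\<^sub>0"
  then have "Im (exp z) = 0" "Re (exp z) \<le> 0"
    by (auto simp: complex_nonpos_Reals_iff)
  then have "sin (Im z) = 0" "cos (Im z) \<le> 0"
    by (auto simp: Re_exp Im_exp mult_le_0_iff)
  moreover from this have "Im z = 0"
    using assms by (metis abs_less_iff minus_less_iff sin_eq_0_pi)
  ultimately show False by simp
qed

text \<open>
  The situation of the main implication.  The last assumption is the scalar assertion: it will confine
  the spectrum of \<open>A\<close> to the nonnegative reals.
\<close>

locale accretive_powers = complex_hilbert_space H for H :: "'a hilbert" (structure) +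
  fixes A :: "'a \<Rightarrow> 'a" and n :: "nat \<Rightarrow> nat"
  assumes bounded: "bounded_operator H A"
    and accretive_power: "\<And>k. accretive (A ^^ n k)"
    and strict_mono_n: "strict_mono n"
    and n_0: "n 0 = 1"
    and negative_power: "\<And>c. c \<notin> \<real>\<^sub>\<ge>\<^sub>0 \<Longrightarrow> \<exists>k. Re (c ^ n k) < 0"
begin

lemmas A_simps = bounded_operator_simps[OF bounded] power_closed[OF bounded]

text \<open>
  A norm bound of \<open>A\<close>; taking it at least \<open>1\<close> makes its powers increasing.
\<close>

definition \<kappa> :: real where
  "\<kappa> = (SOME K. 1 \<le> K \<and> (\<forall>x\<in>carrier H. hnorm H (A x) \<le> K * hnorm H x))"

lemma \<kappa>: "1 \<le> \<kappa>" and hnorm_A_le: "x \<in> carrier H \<Longrightarrow> hnorm H (A x) \<le> \<kappa> * hnorm H x"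
proof -
  have "\<exists>K. 1 \<le> K \<and> (\<forall>x\<in>carrier H. hnorm H (A x) \<le> K * hnorm H x)"
    by (rule bounded_operator_bound[OF bounded])
  from someI_ex[OF this]
  have *: "1 \<le> \<kappa> \<and> (\<forall>x\<in>carrier H. hnorm H (A x) \<le> \<kappa> * hnorm H x)"
    unfolding \<kappa>_def .
  show "1 \<le> \<kappa>" using * by (rule conjunct1)
  show "x \<in> carrier H \<Longrightarrow> hnorm H (A x) \<le> \<kappa> * hnorm H x"
    using * by (rule conjunct2[THEN bspec])
qed

lemma cmod_cinner_A_le:
  assumes "u \<in> carrier H" "y \<in> carrier H"
  shows "cmod (cinner H (A u) y) \<le> \<kappa> * hnorm H u * hnorm H y"
proof -
  have "cmod (cinner H (A u) y) \<le> hnorm H (A u) * hnorm H y"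
    by (rule Cauchy_Schwarz) (simp_all add: assms A_simps)
  also have "\<dots> \<le> \<kappa> * hnorm H u * hnorm H y"
    by (intro mult_right_mono hnorm_A_le assms hnorm_nonneg)
  finally show ?thesis .
qed

lemma n_pos: "0 < n k"
  using strict_mono_less_eq[OF strict_mono_n, of 0 k] n_0 by simp

lemma negative_power_uminus:
  assumes "v \<notin> \<real>\<^sub>\<le>\<^sub>0"
  obtains k where "Re ((- v) ^ n k) < 0"
proof -
  have "- v \<notin> \<real>\<^sub>\<ge>\<^sub>0"
    using assms by (simp add: complex_nonneg_Reals_iff complex_nonpos_Reals_iff)
  then show ?thesis using negative_power that by metis
qed

lemma shift_lower_bound:
  assumes "v \<notin> \<real>\<^sub>\<le>\<^sub>0"
  shows "\<exists>C>0. \<forall>u\<in>carrier H. hnorm H u \<le> C * hnorm H (A u \<oplus> v \<odot> u)"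
proof -
  obtain k where k: "Re ((- v) ^ n k) < 0"
    using negative_power_uminus[OF assms] .
  define L where "L = max \<kappa> (cmod v)"
  have L: "1 \<le> L" "cmod (- v) \<le> L" using \<kappa> by (auto simp: L_def)
  have AL: "hnorm H (A x) \<le> L * hnorm H x" if "x \<in> carrier H" for x
    by (rule order_trans[OF hnorm_A_le[OF that] mult_right_mono])
      (simp_all add: L_def that)
  define d where "d = - Re ((- v) ^ n k)"
  define C where "C = real (n k) * L ^ n k / d"
  have d: "0 < d" using k by (simp add: d_def)
  have "0 < C"
    unfolding C_def using d L(1) n_pos[of k] by (intro divide_pos_pos mult_pos_pos) auto
  moreover have "hnorm H u \<le> C * hnorm H (A u \<oplus> v \<odot> u)" if u: "u \<in> carrier H" for u
  proof -
    have "d * hnorm H u \<le> real (n k) * L ^ n k * hnorm H (A u \<oplus> (- (- v)) \<odot> u)"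
      unfolding d_def by (rule power_accretive_lower_bound[OF bounded L(1) AL L(2) accretive_power u])
    then show ?thesis
      using d by (simp add: C_def pos_le_divide_eq mult.commute)
  qed
  ultimately show ?thesis by (intro exI[of _ C]) simp
qed

text \<open>
  The sign convention \<open>(A + v)\<^sup>-\<^sup>1\<close> puts the excluded values of \<open>v\<close> on the negative real axis, the branch
  cut of the logarithm.
\<close>

definition resolvent :: "complex \<Rightarrow> 'a \<Rightarrow> 'a" where
  "resolvent v x = (SOME u. u \<in> carrier H \<and> A u \<oplus> v \<odot> u = x)"

lemma
  assumes "v \<notin> \<real>\<^sub>\<le>\<^sub>0" and "x \<in> carrier H"
  shows resolvent_closed: "resolvent v x \<in> carrier H"
    and resolvent_eq: "A (resolvent v x) \<oplus> v \<odot> resolvent v x = x"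
proof -
  obtain k where k: "Re ((- v) ^ n k) < 0"
    using negative_power_uminus[OF assms(1)] .
  have "\<exists>u\<in>carrier H. A u \<oplus> (- (- v)) \<odot> u = x"
    by (rule power_accretive_surj[OF bounded accretive_power k assms(2)])
  then have "\<exists>u. u \<in> carrier H \<and> A u \<oplus> v \<odot> u = x"
    by (simp add: Bex_def)
  from someI_ex[OF this]
  have "resolvent v x \<in> carrier H \<and> A (resolvent v x) \<oplus> v \<odot> resolvent v x = x"
    unfolding resolvent_def .
  then show "resolvent v x \<in> carrier H" "A (resolvent v x) \<oplus> v \<odot> resolvent v x = x"
    by simp_all
qed

lemma resolvent_unique:
  assumes v: "v \<notin> \<real>\<^sub>\<le>\<^sub>0" and u: "u \<in> carrier H"
  shows "resolvent v (A u \<oplus> v \<odot> u) = u"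
proof -
  define x where "x = A u \<oplus> v \<odot> u"
  have x: "x \<in> carrier H" by (simp add: x_def u A_simps)
  let ?r = "resolvent v x"
  note r = resolvent_closed[OF v x]
  obtain C where C: "\<forall>u\<in>carrier H. hnorm H u \<le> C * hnorm H (A u \<oplus> v \<odot> u)"
    using shift_lower_bound[OF v] by metis
  have "A (?r \<ominus> u) \<oplus> v \<odot> (?r \<ominus> u) = (A ?r \<oplus> v \<odot> ?r) \<ominus> (A u \<oplus> v \<odot> u)"
    by (rule vector_eqI) (simp_all add: r u A_simps cinner_simps algebra_simps)
  also have "\<dots> = \<zero>"
    unfolding resolvent_eq[OF v x] by (simp add: x_def[symmetric] x diff_eq_zero_iff)
  finally have "hnorm H (?r \<ominus> u) \<le> 0"
    using bspec[OF C M.minus_closed[OF r u]] by simp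
  then have "hnorm H (?r \<ominus> u) = 0"
    using hnorm_nonneg[OF M.minus_closed[OF r u]] by linarith
  then have "?r \<ominus> u = \<zero>"
    by (rule hnorm_eq_0[rotated]) (simp add: r u)
  then show ?thesis
    using r u by (simp add: diff_eq_zero_iff flip: x_def)
qed

lemma resolvent_identity:
  assumes v: "v \<notin> \<real>\<^sub>\<le>\<^sub>0" and v0: "v0 \<notin> \<real>\<^sub>\<le>\<^sub>0" and x: "x \<in> carrier H"
  shows "resolvent v x = resolvent v0 x \<oplus> (v0 - v) \<odot> resolvent v (resolvent v0 x)"
proof -
  define r where "r = resolvent v0 x"
  define q where "q = resolvent v r"
  have r: "r \<in> carrier H" unfolding r_def by (rule resolvent_closed[OF v0 x])
  have q: "q \<in> carrier H" unfolding q_def by (rule resolvent_closed[OF v r])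
  have er: "A r \<oplus> v0 \<odot> r = x" unfolding r_def by (rule resolvent_eq[OF v0 x])
  have eq: "A q \<oplus> v \<odot> q = r" unfolding q_def by (rule resolvent_eq[OF v r])
  let ?u = "r \<oplus> (v0 - v) \<odot> q"
  have "A ?u \<oplus> v \<odot> ?u = x"
  proof (rule vector_eqI)
    fix z assume z: "z \<in> carrier H"
    have "cinner H x z = cinner H (A r) z + v0 * cinner H r z"
      unfolding er[symmetric] by (simp add: r z A_simps cinner_simps)
    moreover have "cinner H r z = cinner H (A q) z + v * cinner H q z"
      by (subst eq[symmetric]) (simp add: q z A_simps cinner_simps)
    ultimately show "cinner H (A ?u \<oplus> v \<odot> ?u) z = cinner H x z"
      by (simp add: q r z A_simps cinner_simps algebra_simps)
  qed (simp_all add: q r x A_simps)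
  moreover have "?u \<in> carrier H"
    using q r by simp
  ultimately have "resolvent v x = ?u"
    using resolvent_unique[OF v] by metis
  then show ?thesis by (simp only: q_def r_def)
qed

text \<open>
  A perturbation of \<open>v0\<close> by less than half the reciprocal of the resolvent bound at \<open>v0\<close> at most
  doubles that bound.
\<close>

lemma resolvent_locally_bounded:
  assumes v0: "v0 \<notin> \<real>\<^sub>\<le>\<^sub>0"
  obtains C d where "0 < C" "0 < d"
    and "\<And>v. cmod (v - v0) < d \<Longrightarrow> v \<notin> \<real>\<^sub>\<le>\<^sub>0"
    and "\<And>v x. cmod (v - v0) < d \<Longrightarrow> x \<in> carrier H \<Longrightarrow> hnorm H (resolvent v x) \<le> C * hnorm H x"
proof -
  obtain C where C: "0 < C" "\<forall>u\<in>carrier H. hnorm H u \<le> C * hnorm H (A u \<oplus> v0 \<odot> u)"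
    using shift_lower_bound[OF v0] by metis
  have "open (- \<real>\<^sub>\<le>\<^sub>0 :: complex set)"
    by (rule open_Compl[OF closed_nonpos_Reals_complex])
  then obtain d0 where d0: "0 < d0" "ball v0 d0 \<subseteq> - \<real>\<^sub>\<le>\<^sub>0"
    using v0 by (auto simp: open_contains_ball)
  define d where "d = min d0 (1 / (2 * C))"
  have out: "v \<notin> \<real>\<^sub>\<le>\<^sub>0" if "cmod (v - v0) < d" for v
    using that d0(2) by (auto simp: d_def subset_iff dist_norm norm_minus_commute)
  have "hnorm H (resolvent v x) \<le> 2 * C * hnorm H x"
    if v: "cmod (v - v0) < d" and x: "x \<in> carrier H" for v x
  proof -
    define u where "u = resolvent v x"
    have u: "u \<in> carrier H" "A u \<oplus> v \<odot> u = x"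
      unfolding u_def using resolvent_closed[OF out[OF v] x] resolvent_eq[OF out[OF v] x] by simp_all
    have "A u \<oplus> v0 \<odot> u = x \<oplus> (v0 - v) \<odot> u"
      unfolding u(2)[symmetric]
      by (rule vector_eqI) (simp_all add: u(1) A_simps cinner_simps algebra_simps)
    then have "hnorm H u \<le> C * hnorm H (x \<oplus> (v0 - v) \<odot> u)"
      using bspec[OF C(2) u(1)] by simp
    also have "\<dots> \<le> C * (hnorm H x + cmod (v0 - v) * hnorm H u)"
      using C(1) hnorm_triangle[of x "(v0 - v) \<odot> u"] x u(1)
      by (intro mult_left_mono) (simp_all add: hnorm_smult)
    also have "\<dots> = C * hnorm H x + (C * cmod (v - v0)) * hnorm H u"
      by (simp add: algebra_simps norm_minus_commute)
    also have "\<dots> \<le> C * hnorm H x + 1 / 2 * hnorm H u"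
    proof -
      have "C * cmod (v - v0) \<le> C * (1 / (2 * C))"
        using v C(1) by (intro mult_left_mono) (auto simp: d_def)
      then have "C * cmod (v - v0) \<le> 1 / 2"
        using C(1) by simp
      then show ?thesis
        using u(1) by (intro add_left_mono mult_right_mono) simp_all
    qed
    finally show ?thesis by (simp add: u_def)
  qed
  moreover have "0 < 2 * C" "0 < d" using C(1) d0(1) by (simp_all add: d_def)
  ultimately show ?thesis using that[of "2 * C" d] out by metis
qed

text \<open>
  Continuity and then differentiability follow from the resolvent identity, which expresses
  the increment through the resolvent itself.
\<close>

lemma isCont_resolvent:
  assumes v0: "v0 \<notin> \<real>\<^sub>\<le>\<^sub>0" and x: "x \<in> carrier H" and y: "y \<in> carrier H"
  shows "isCont (\<lambda>v. cinner H (A (resolvent v x)) y) v0"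
proof -
  obtain C d where C: "0 < C" and d: "0 < d"
    and out: "\<And>v. cmod (v - v0) < d \<Longrightarrow> v \<notin> \<real>\<^sub>\<le>\<^sub>0"
    and bnd: "\<And>v x. cmod (v - v0) < d \<Longrightarrow> x \<in> carrier H \<Longrightarrow> hnorm H (resolvent v x) \<le> C * hnorm H x"
    using resolvent_locally_bounded[OF v0] by metis
  define r where "r = resolvent v0 x"
  have r: "r \<in> carrier H" unfolding r_def by (rule resolvent_closed[OF v0 x])
  define B where "B = \<kappa> * (C * hnorm H r) * hnorm H y"
  have "((\<lambda>v. cmod (v - v0) * B) \<longlongrightarrow> cmod (v0 - v0) * B) (at v0)"
    by (intro tendsto_intros)
  then have null: "((\<lambda>v. cmod (v - v0) * B) \<longlongrightarrow> 0) (at v0)"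
    by simp
  have "eventually (\<lambda>v. dist v v0 < d) (at v0)"
    using d by (auto simp: eventually_at)
  then have "eventually (\<lambda>v. norm (cinner H (A (resolvent v x)) y - cinner H (A r) y)
      \<le> cmod (v - v0) * B) (at v0)"
  proof (rule eventually_mono)
    fix v assume "dist v v0 < d"
    then have v: "cmod (v - v0) < d" by (simp add: dist_norm)
    have q: "resolvent v r \<in> carrier H" by (rule resolvent_closed[OF out[OF v] r])
    have "resolvent v x = r \<oplus> (v0 - v) \<odot> resolvent v r"
      unfolding r_def by (rule resolvent_identity[OF out[OF v] v0 x])
    then have "cinner H (A (resolvent v x)) y - cinner H (A r) y
        = (v0 - v) * cinner H (A (resolvent v r)) y"
      using q r y by (simp add: A_simps cinner_simps)
    then have "norm (cinner H (A (resolvent v x)) y - cinner H (A r) y)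
        = cmod (v - v0) * cmod (cinner H (A (resolvent v r)) y)"
      by (simp add: norm_mult norm_minus_commute)
    also have "\<dots> \<le> cmod (v - v0) * (\<kappa> * hnorm H (resolvent v r) * hnorm H y)"
      by (intro mult_left_mono cmod_cinner_A_le q y norm_ge_zero)
    also have "\<dots> \<le> cmod (v - v0) * B"
      unfolding B_def using \<kappa> y
      by (intro mult_left_mono mult_right_mono bnd[OF v r]) auto
    finally show "norm (cinner H (A (resolvent v x)) y - cinner H (A r) y) \<le> cmod (v - v0) * B" .
  qed
  from Lim_null_comparison[OF this null]
  show ?thesis
    unfolding isCont_def r_def by (simp add: LIM_zero_iff)
qed

lemma resolvent_has_field_derivative:
  assumes v0: "v0 \<notin> \<real>\<^sub>\<le>\<^sub>0" and x: "x \<in> carrier H" and y: "y \<in> carrier H"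
  shows "((\<lambda>v. cinner H (A (resolvent v x)) y) has_field_derivative
    - cinner H (A (resolvent v0 (resolvent v0 x))) y) (at v0)"
proof -
  define r where "r = resolvent v0 x"
  have r: "r \<in> carrier H" unfolding r_def by (rule resolvent_closed[OF v0 x])
  have "((\<lambda>v. - cinner H (A (resolvent v r)) y) \<longlongrightarrow> - cinner H (A (resolvent v0 r)) y) (at v0)"
    using isCont_resolvent[OF v0 r y] by (intro tendsto_minus) (simp add: isCont_def)
  moreover have "eventually (\<lambda>v. - cinner H (A (resolvent v r)) y =
      (cinner H (A (resolvent v x)) y - cinner H (A (resolvent v0 x)) y) / (v - v0)) (at v0)"
  proof -
    obtain C d where d: "0 < d" and out: "\<And>v. cmod (v - v0) < d \<Longrightarrow> v \<notin> \<real>\<^sub>\<le>\<^sub>0"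
      using resolvent_locally_bounded[OF v0] by metis
    have "eventually (\<lambda>v. v \<noteq> v0 \<and> dist v v0 < d) (at v0)"
      using d by (auto simp: eventually_at)
    then show ?thesis
    proof (rule eventually_mono)
      fix v assume vv: "v \<noteq> v0 \<and> dist v v0 < d"
      then have v: "v \<notin> \<real>\<^sub>\<le>\<^sub>0" using out by (simp add: dist_norm)
      have q: "resolvent v r \<in> carrier H" by (rule resolvent_closed[OF v r])
      have "resolvent v x = r \<oplus> (v0 - v) \<odot> resolvent v r"
        unfolding r_def by (rule resolvent_identity[OF v v0 x])
      then have "cinner H (A (resolvent v x)) y - cinner H (A r) y
          = - (v - v0) * cinner H (A (resolvent v r)) y"
        using q r y by (simp add: A_simps cinner_simps)
      then show "- cinner H (A (resolvent v r)) y =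
          (cinner H (A (resolvent v x)) y - cinner H (A (resolvent v0 x)) y) / (v - v0)"
        using vv by (simp add: r_def[symmetric] nonzero_eq_divide_eq algebra_simps)
    qed
  qed
  ultimately show ?thesis
    unfolding has_field_derivative_iff r_def[symmetric] by (rule Lim_transform_eventually)
qed

lemma resolvent_form_holomorphic:
  assumes x: "x \<in> carrier H" and y: "y \<in> carrier H"
  shows "(\<lambda>z. exp z * cinner H (A (resolvent (exp z) x)) y) holomorphic_on {z. \<bar>Im z\<bar> < pi}"
proof (rule holomorphic_on_mult)
  have "((\<lambda>v. cinner H (A (resolvent v x)) y) \<circ> exp) holomorphic_on {z. \<bar>Im z\<bar> < pi}"
  proof (rule holomorphic_on_compose_gen[where t = "- \<real>\<^sub>\<le>\<^sub>0"])
    show "(\<lambda>v. cinner H (A (resolvent v x)) y) holomorphic_on - \<real>\<^sub>\<le>\<^sub>0"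
      unfolding holomorphic_on_def field_differentiable_def
    proof (intro ballI exI)
      fix v :: complex assume "v \<in> - \<real>\<^sub>\<le>\<^sub>0"
      then show "((\<lambda>v. cinner H (A (resolvent v x)) y) has_field_derivative
          - cinner H (A (resolvent v (resolvent v x))) y) (at v within - \<real>\<^sub>\<le>\<^sub>0)"
        by (intro has_field_derivative_at_within[OF resolvent_has_field_derivative[OF _ x y]]) simp
    qed
  qed (use exp_notin_nonpos_Reals in \<open>auto intro: holomorphic_intros\<close>)
  then show "(\<lambda>z. cinner H (A (resolvent (exp z) x)) y) holomorphic_on {z. \<bar>Im z\<bar> < pi}"
    by (simp add: comp_def)
qed (intro holomorphic_intros)

text \<open>
  \<open>v A (A + v)\<^sup>-\<^sup>1 = A - A\<^sup>2 (A + v)\<^sup>-\<^sup>1\<close>, and the resolvent is \<open>O(1 / \<bar>v\<bar>)\<close>.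
\<close>

lemma resolvent_form_at_top:
  assumes x: "x \<in> carrier H" and y: "y \<in> carrier H" and e: "0 < e" and b: "b < pi"
  shows "\<exists>T. \<forall>z. T \<le> Re z \<longrightarrow> \<bar>Im z\<bar> \<le> b \<longrightarrow>
    cmod (exp z * cinner H (A (resolvent (exp z) x)) y - cinner H (A x) y) \<le> e"
proof -
  define G where "G = 2 * \<kappa>\<^sup>2 * hnorm H x * hnorm H y"
  \<comment> \<open>The summand \<open>2 * \<kappa>\<close> bounds the resolvent by \<open>2 / \<bar>v\<bar>\<close>, the other one brings the error below \<open>e\<close>.\<close>
  define \<rho> where "\<rho> = 2 * \<kappa> + G / e"
  have G: "0 \<le> G" using x y by (simp add: G_def)
  then have \<rho>: "0 < \<rho>" using \<kappa> e by (auto simp: \<rho>_def intro!: add_pos_nonneg)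
  have "cmod (exp z * cinner H (A (resolvent (exp z) x)) y - cinner H (A x) y) \<le> e"
    if z: "ln \<rho> \<le> Re z" "\<bar>Im z\<bar> \<le> b" for z
  proof -
    define v where "v = exp z"
    have v: "v \<notin> \<real>\<^sub>\<le>\<^sub>0" unfolding v_def using z b by (intro exp_notin_nonpos_Reals) auto
    have v\<rho>: "\<rho> \<le> cmod v" using z \<rho> by (simp add: v_def ln_le_cancel_iff[symmetric] del: ln_le_cancel_iff)
    then have v0: "0 < cmod v" using \<rho> by linarith
    define r where "r = resolvent v x"
    have r: "r \<in> carrier H" "A r \<oplus> v \<odot> r = x"
      unfolding r_def using resolvent_closed[OF v x] resolvent_eq[OF v x] by simp_all
    have "v \<odot> r = x \<ominus> A r"
      unfolding r(2)[symmetric] by (rule vector_eqI) (simp_all add: r(1) A_simps cinner_simps)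
    then have "cmod v * hnorm H r \<le> hnorm H x + hnorm H (A r)"
      using hnorm_smult[OF r(1), of v] hnorm_triangle_diff[of x "A r"] x r(1) by (simp add: A_simps)
    also have "\<dots> \<le> hnorm H x + \<kappa> * hnorm H r"
      using hnorm_A_le[OF r(1)] by simp
    also have "\<dots> \<le> hnorm H x + cmod v / 2 * hnorm H r"
    proof -
      have "0 \<le> G / e" using G e by simp
      then have "\<kappa> \<le> cmod v / 2" using v\<rho> unfolding \<rho>_def by linarith
      then show ?thesis using r(1) by (intro add_left_mono mult_right_mono) simp_all
    qed
    finally have rle: "cmod v * hnorm H r \<le> 2 * hnorm H x" by simp
    have "A (A r) \<oplus> v \<odot> A r = A (A r \<oplus> v \<odot> r)"
      using r(1) by (simp add: A_simps)
    then have "cinner H (A x) y = cinner H (A (A r) \<oplus> v \<odot> A r) y"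
      by (simp add: r(2))
    then have "cmod (v * cinner H (A r) y - cinner H (A x) y) = cmod (cinner H (A (A r)) y)"
      using r(1) y by (simp add: A_simps cinner_simps norm_minus_commute)
    also have "\<dots> \<le> \<kappa> * hnorm H (A r) * hnorm H y"
      using r(1) y by (intro cmod_cinner_A_le) (simp_all add: A_simps)
    also have "\<dots> \<le> \<kappa> * (\<kappa> * hnorm H r) * hnorm H y"
      using \<kappa> y by (intro mult_left_mono mult_right_mono hnorm_A_le r(1)) simp_all
    also have "\<dots> \<le> \<kappa> * (\<kappa> * (2 * hnorm H x / cmod v)) * hnorm H y"
      using \<kappa> y rle v0 by (intro mult_left_mono mult_right_mono) (simp_all add: pos_le_divide_eq mult.commute)
    also have "\<dots> = G / cmod v"
      by (simp add: G_def power2_eq_square)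
    also have "\<dots> \<le> e"
    proof -
      have "G / e \<le> cmod v" using v\<rho> \<kappa> by (simp add: \<rho>_def)
      then show ?thesis using e v0 by (simp add: pos_divide_le_eq mult.commute)
    qed
    finally show ?thesis by (simp add: v_def r_def)
  qed
  then show ?thesis by metis
qed

text \<open>
  On a compact arc of directions that avoids the positive axis, finitely many exponents \<open>n k\<close> turn every
  direction into the open left half-plane, uniformly.  Hence the resolvent is
  \<open>O(\<bar>v\<bar>\<^sup>-\<^sup>N)\<close> near \<open>0\<close> for a fixed \<open>N\<close>.  This growth is absorbed by \<open>A\<^sup>N\<close>: with \<open>w = - v\<close>,
  \<open>(A - w)\<^sup>-\<^sup>1 A\<^sup>N = Q + w\<^sup>N (A - w)\<^sup>-\<^sup>1\<close>, where \<open>Q\<close> is a polynomial in \<open>A\<close> and \<open>w\<close>,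
  stays bounded, and the remaining factor \<open>e\<^sup>z\<close> tends to \<open>0\<close>.
\<close>

lemma resolvent_form_at_bot:
  assumes b: "b < pi"
  obtains N where "\<And>h y e. h \<in> carrier H \<Longrightarrow> y \<in> carrier H \<Longrightarrow> 0 < e \<Longrightarrow>
    \<exists>T. \<forall>z. Re z \<le> T \<longrightarrow> \<bar>Im z\<bar> \<le> b \<longrightarrow>
      cmod (exp z * cinner H (A (resolvent (exp z) ((A ^^ N) h))) y) \<le> e"
proof -
  define S where "S = (\<lambda>t. - cis t) ` {- b..b}"
  have "compact S"
    unfolding S_def by (intro compact_continuous_image continuous_intros) simp_all
  moreover have "continuous_on UNIV (\<lambda>w :: complex. Re (w ^ n k))" for k
    by (intro continuous_intros)
  moreover have "\<exists>k. Re (w ^ n k) < 0" if w: "w \<in> S" for w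
  proof -
    obtain t where t: "w = - cis t" "\<bar>t\<bar> \<le> b" using w by (auto simp: S_def)
    then have "cis t \<notin> \<real>\<^sub>\<le>\<^sub>0"
      using exp_notin_nonpos_Reals[of "\<i> * of_real t"] b by (simp add: cis_conv_exp)
    then show ?thesis using t by (metis negative_power_uminus)
  qed
  ultimately obtain K0 \<delta> where \<delta>: "0 < \<delta>"
    and K0: "\<And>w. w \<in> S \<Longrightarrow> \<exists>k\<le>K0. Re (w ^ n k) \<le> - \<delta>"
    using compact_uniformly_negative[of S "\<lambda>k w. Re (w ^ n k)"] by metis
  define N where "N = n K0"
  define C where "C = real N * \<kappa> ^ N + real N * \<kappa> ^ N / \<delta>"
  have C: "0 \<le> C" using \<kappa> \<delta> by (simp add: C_def)
  have bound: "cmod (exp z * cinner H (A (resolvent (exp z) ((A ^^ N) h))) y)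
      \<le> exp (Re z) * (\<kappa> * (C * hnorm H h) * hnorm H y)"
    if z: "Re z \<le> 0" "\<bar>Im z\<bar> \<le> b" and h: "h \<in> carrier H" and y: "y \<in> carrier H" for z h y
  proof -
    define v where "v = exp z"
    define \<rho> where "\<rho> = exp (Re z)"
    have v: "v \<notin> \<real>\<^sub>\<le>\<^sub>0" unfolding v_def using z b by (intro exp_notin_nonpos_Reals) auto
    have \<rho>: "0 < \<rho>" "\<rho> \<le> 1" using z by (simp_all add: \<rho>_def)
    have v_polar: "- v = of_real \<rho> * (- cis (Im z))"
      by (simp add: v_def \<rho>_def exp_eq_polar)
    have "cmod (- v) = \<rho>" by (simp add: v_def \<rho>_def)
    then have vk: "cmod (- v) \<le> \<kappa>" using \<rho> \<kappa> by linarith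
    have "- cis (Im z) \<in> S" using z unfolding S_def by (intro imageI) auto
    then obtain k where k: "k \<le> K0" "Re ((- cis (Im z)) ^ n k) \<le> - \<delta>"
      using K0 by metis
    define m where "m = n k"
    have mN: "m \<le> N" unfolding m_def N_def using k strict_mono_n by (simp add: strict_mono_less_eq)
    have "(- v) ^ m = of_real (\<rho> ^ m) * (- cis (Im z)) ^ m"
      unfolding v_polar power_mult_distrib by simp
    then have "Re ((- v) ^ m) = \<rho> ^ m * Re ((- cis (Im z)) ^ m)"
      by simp
    also have "\<dots> \<le> \<rho> ^ m * - \<delta>"
      using k \<rho> unfolding m_def by (intro mult_left_mono) auto
    finally have Re_v: "\<delta> * \<rho> ^ m \<le> - Re ((- v) ^ m)" by (simp add: mult.commute)
    have low: "\<rho> ^ N * hnorm H u \<le> real N * \<kappa> ^ N / \<delta> * hnorm H (A u \<oplus> v \<odot> u)"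
      if u: "u \<in> carrier H" for u
    proof -
      have s: "0 \<le> hnorm H (A u \<oplus> v \<odot> u)" using u by (simp add: A_simps)
      have "\<delta> * (\<rho> ^ N * hnorm H u) \<le> \<delta> * \<rho> ^ m * hnorm H u"
        unfolding mult.assoc using \<delta> \<rho> u mN by (intro mult_left_mono mult_right_mono power_decreasing) auto
      also have "\<dots> \<le> - Re ((- v) ^ m) * hnorm H u"
        by (intro mult_right_mono Re_v hnorm_nonneg u)
      also have "\<dots> \<le> real m * \<kappa> ^ m * hnorm H (A u \<oplus> (- (- v)) \<odot> u)"
        unfolding m_def
        by (rule power_accretive_lower_bound[OF bounded \<kappa> hnorm_A_le vk accretive_power u])
      also have "\<dots> \<le> real N * \<kappa> ^ N * hnorm H (A u \<oplus> v \<odot> u)"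
        unfolding minus_minus using s mN \<kappa> by (intro mult_right_mono mult_mono power_increasing) auto
      finally show ?thesis using \<delta> by (simp add: pos_le_divide_eq mult.commute)
    qed
    define q where "q = power_quotient A (- v) N h"
    define r where "r = resolvent v h"
    have q: "q \<in> carrier H" unfolding q_def by (rule power_quotient_closed[OF bounded h])
    have r: "r \<in> carrier H" "A r \<oplus> v \<odot> r = h"
      unfolding r_def using resolvent_closed[OF v h] resolvent_eq[OF v h] by simp_all
    \<comment> \<open>The vector \<open>u\<close> is the resolvent of \<open>(A ^^ N) h\<close>, written without negative powers of \<open>v\<close>.\<close>
    define u where "u = q \<oplus> (- v) ^ N \<odot> r"
    have u: "u \<in> carrier H" using q r by (simp add: u_def)
    have qeq: "A q \<oplus> v \<odot> q = (A ^^ N) h \<oplus> (- ((- v) ^ N)) \<odot> h"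
      using power_quotient_right[OF bounded h, of "- v" N] by (simp add: q_def)
    have "A u \<oplus> v \<odot> u = (A q \<oplus> v \<odot> q) \<oplus> (- v) ^ N \<odot> (A r \<oplus> v \<odot> r)"
      unfolding u_def by (rule vector_eqI) (simp_all add: q r(1) A_simps cinner_simps algebra_simps)
    also have "\<dots> = (A ^^ N) h"
      unfolding qeq r(2) by (rule vector_eqI) (simp_all add: h A_simps cinner_simps)
    finally have "resolvent v ((A ^^ N) h) = u"
      using resolvent_unique[OF v u] by simp
    moreover have "hnorm H u \<le> C * hnorm H h"
    proof -
      have "hnorm H u \<le> hnorm H q + \<rho> ^ N * hnorm H r"
        using hnorm_triangle[of q "(- v) ^ N \<odot> r"] q r(1)
        by (simp add: u_def hnorm_smult norm_power v_def \<rho>_def)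
      also have "\<dots> \<le> real N * \<kappa> ^ N * hnorm H h + real N * \<kappa> ^ N / \<delta> * hnorm H h"
      proof (rule add_mono)
        show "hnorm H q \<le> real N * \<kappa> ^ N * hnorm H h"
          unfolding q_def using \<kappa> by (intro hnorm_power_quotient_le[OF bounded] hnorm_A_le vk h) auto
        show "\<rho> ^ N * hnorm H r \<le> real N * \<kappa> ^ N / \<delta> * hnorm H h"
          using low[OF r(1)] by (simp only: r(2))
      qed
      finally show ?thesis by (simp add: C_def algebra_simps)
    qed
    ultimately have "cmod (cinner H (A (resolvent v ((A ^^ N) h))) y) \<le> \<kappa> * (C * hnorm H h) * hnorm H y"
      using \<kappa> y by (intro order_trans[OF cmod_cinner_A_le] mult_left_mono mult_right_mono) (simp_all add: u)
    then show ?thesis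
      by (simp add: norm_mult v_def mult_left_mono)
  qed
  show ?thesis
  proof (rule that)
    fix h y and e :: real
    assume hy: "h \<in> carrier H" "y \<in> carrier H" and e: "0 < e"
    define G where "G = \<kappa> * (C * hnorm H h) * hnorm H y"
    have G: "0 \<le> G" using \<kappa> C hy by (simp add: G_def)
    have "cmod (exp z * cinner H (A (resolvent (exp z) ((A ^^ N) h))) y) \<le> e"
      if z: "Re z \<le> min 0 (ln (e / (G + 1)))" "\<bar>Im z\<bar> \<le> b" for z
    proof -
      have "exp (Re z) \<le> exp (ln (e / (G + 1)))" using z by simp
      then have "exp (Re z) * G \<le> e / (G + 1) * G"
        using G e by (intro mult_right_mono) simp_all
      also have "\<dots> \<le> e" using G e by (simp add: field_simps)
      finally show ?thesis
        using bound[of z h y] z hy unfolding G_def by simp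
    qed
    then show "\<exists>T. \<forall>z. Re z \<le> T \<longrightarrow> \<bar>Im z\<bar> \<le> b \<longrightarrow>
        cmod (exp z * cinner H (A (resolvent (exp z) ((A ^^ N) h))) y) \<le> e"
      by metis
  qed
qed

section \<open>Numerical range in ever smaller sectors\<close>

text \<open>
  The points \<open>- v j\<close> are the \<open>m\<close>-th roots of a number \<open>- \<mu>\<close> with \<open>\<mu> = \<rho> e\<^sup>i\<^sup>\<phi>\<close>, \<open>\<rho> > 0\<close>.  By partial fractions
  \<open>\<Sum> A (A + v j)\<^sup>-\<^sup>1 = m A\<^sup>m (A\<^sup>m + \<mu>)\<^sup>-\<^sup>1\<close>, and the weights cancel the rotation of \<open>v j\<close>.  If
  \<open>(A\<^sup>m + \<mu>) u = x\<close>, then \<open>\<langle>A\<^sup>m u, x\<rangle> = \<parallel>A\<^sup>m u\<parallel>\<^sup>2 + \<rho> e\<^sup>-\<^sup>i\<^sup>\<phi> \<langle>A\<^sup>m u, u\<rangle>\<close>; multiplication by \<open>e\<^sup>i\<^sup>\<phi>\<close> leaves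
  two terms with nonnegative real part.
\<close>

lemma rotated_resolvents_nonneg:
  assumes \<phi>: "\<bar>\<phi>\<bar> < pi / 2" and x: "x \<in> carrier H" and m: "m = n k"
    and \<beta>: "\<beta> = - pi + (pi + \<phi>) / real m"
    and range: "\<And>j. j < m \<Longrightarrow> \<bar>\<beta> + 2 * pi * real j / real m\<bar> < pi"
    and v: "\<And>j. v j = exp (of_real t + \<i> * of_real (\<beta> + 2 * pi * real j / real m))"
  shows "0 \<le> Re (cis (\<phi> - \<beta>) * (\<Sum>j<m. cis (- (2 * pi * real j / real m)) *
    (v j * cinner H (A (resolvent (v j) x)) x)))"
proof -
  have m0: "0 < m" using n_pos by (simp add: m)
  define E where "E = exp t"
  have E: "0 < E" by (simp add: E_def)
  have v_polar: "v j = of_real E * cis (\<beta> + 2 * pi * real j / real m)" for j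
    unfolding v by (simp add: E_def exp_add cis_conv_exp exp_of_real)
  have v_rot: "v j = v 0 * cis (2 * pi * real j / real m)" for j
    unfolding v_polar by (simp add: cis_mult)
  have v_out: "v j \<notin> \<real>\<^sub>\<le>\<^sub>0" if "j < m" for j
    unfolding v by (rule exp_notin_nonpos_Reals) (use range[OF that] in simp)
  define \<mu> where "\<mu> = of_real (E ^ m) * cis \<phi>"
  have v_power: "(- v j) ^ m = - \<mu>" for j
  proof -
    have "- v j = of_real E * cis (\<beta> + 2 * pi * real j / real m + pi)"
      unfolding v_polar by (simp add: cis_mult[symmetric])
    then have "(- v j) ^ m = of_real (E ^ m) * cis (real m * (\<beta> + 2 * pi * real j / real m + pi))"
      by (simp only: power_mult_distrib Complex.DeMoivre of_real_power)
    also have "real m * (\<beta> + 2 * pi * real j / real m + pi) = \<phi> + pi + 2 * pi * real j"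
      using m0 by (simp add: \<beta> field_simps)
    also have "cis (\<phi> + pi + 2 * pi * real j) = - cis \<phi>"
      by (simp add: cis_mult[symmetric] cis_multiple_2pi)
    finally show ?thesis by (simp add: \<mu>_def)
  qed
  have cos: "0 < cos \<phi>" using \<phi> by (intro cos_gt_zero_pi) auto
  note Am = bounded_operator_power[OF bounded, of m]
  have acc: "accretive (A ^^ m)" unfolding m by (rule accretive_power)
  have "0 < Re \<mu>" using cos E by (simp add: \<mu>_def)
  then obtain u where u: "u \<in> carrier H" and ux: "(A ^^ m) u \<oplus> \<mu> \<odot> u = x"
    using accretive_add_scalar_surj[OF Am acc _ x] by metis
  have res: "resolvent (v j) x = power_quotient A (- v j) m u" if "j < m" for j
  proof -
    let ?q = "power_quotient A (- v j) m u"
    have "A ?q \<oplus> v j \<odot> ?q = x"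
      using power_quotient_right[OF bounded u, of "- v j" m] by (simp add: v_power ux)
    then show ?thesis
      using resolvent_unique[OF v_out[OF that] power_quotient_closed[OF bounded u, of "- v j" m]] by simp
  qed
  define g where "g i = cinner H ((A ^^ Suc i) u) x" for i
  have form: "cinner H (A (resolvent (v j) x)) x = (\<Sum>i<m. (- v j) ^ (m - 1 - i) * g i)"
    if "j < m" for j
    using cinner_power_quotient[OF bounded u x, of 1 "- v j" m]
    by (simp add: res[OF that] g_def)
  have sum_v: "(\<Sum>j<m. (- v j) ^ (m - 1 - i)) = (if i = m - 1 then of_nat m else 0)" if "i < m" for i
  proof -
    have "(\<Sum>j<m. (- v j) ^ (m - 1 - i)) = (- v 0) ^ (m - 1 - i) * (\<Sum>j<m. cis (2 * pi * real j / real m) ^ (m - 1 - i))"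
    proof -
      have "(- v j) ^ (m - 1 - i) = (- v 0) ^ (m - 1 - i) * cis (2 * pi * real j / real m) ^ (m - 1 - i)" for j
        unfolding v_rot[of j] by (simp only: power_mult_distrib[symmetric] mult_minus_left)
      then show ?thesis unfolding sum_distrib_left by (rule sum.cong[OF refl])
    qed
    then show ?thesis
      using sum_roots_of_unity_power[of "m - 1 - i" m] that by auto
  qed
  have "(\<Sum>j<m. cis (- (2 * pi * real j / real m)) * (v j * cinner H (A (resolvent (v j) x)) x))
      = (\<Sum>j<m. v 0 * (\<Sum>i<m. (- v j) ^ (m - 1 - i) * g i))"
  proof (rule sum.cong)
    fix j assume "j \<in> {..<m}"
    then have j: "j < m" by simp
    have "cis (- (2 * pi * real j / real m)) * v j = v 0"
      unfolding v_rot[of j] by (simp add: cis_mult mult.left_commute)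
    then show "cis (- (2 * pi * real j / real m)) * (v j * cinner H (A (resolvent (v j) x)) x)
        = v 0 * (\<Sum>i<m. (- v j) ^ (m - 1 - i) * g i)"
      by (simp only: form[OF j] mult.assoc[symmetric])
  qed simp
  also have "\<dots> = v 0 * (\<Sum>i<m. (\<Sum>j<m. (- v j) ^ (m - 1 - i)) * g i)"
    unfolding sum_distrib_left[symmetric] sum_distrib_right by (subst sum.swap) (rule refl)
  also have "(\<Sum>i<m. (\<Sum>j<m. (- v j) ^ (m - 1 - i)) * g i) = (\<Sum>i<m. if i = m - 1 then of_nat m * g (m - 1) else 0)"
  proof (rule sum.cong[OF refl])
    fix i assume "i \<in> {..<m}"
    then show "(\<Sum>j<m. (- v j) ^ (m - 1 - i)) * g i = (if i = m - 1 then of_nat m * g (m - 1) else 0)"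
      by (simp only: sum_v lessThan_iff) simp
  qed
  also have "\<dots> = of_nat m * g (m - 1)"
    using m0 by simp
  finally have total: "(\<Sum>j<m. cis (- (2 * pi * real j / real m)) * (v j * cinner H (A (resolvent (v j) x)) x))
      = v 0 * (of_nat m * g (m - 1))" .
  have Amu: "(A ^^ m) u \<in> carrier H" by (rule power_closed[OF bounded u])
  have "g (m - 1) = cinner H ((A ^^ m) u) ((A ^^ m) u \<oplus> \<mu> \<odot> u)"
    using m0 by (simp only: g_def ux Suc_pred' diff_Suc_1 One_nat_def Suc_pred)
  also have "\<dots> = of_real ((hnorm H ((A ^^ m) u))\<^sup>2) + cnj \<mu> * cinner H ((A ^^ m) u) u"
    using Amu u by (simp add: cinner_simps cinner_self)
  finally have g: "g (m - 1) = of_real ((hnorm H ((A ^^ m) u))\<^sup>2) + cnj \<mu> * cinner H ((A ^^ m) u) u" .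
  have "cis \<phi> * cnj \<mu> = of_real (E ^ m)"
    by (simp add: \<mu>_def cis_cnj cis_mult mult.left_commute)
  then have "cis \<phi> * g (m - 1) = of_real ((hnorm H ((A ^^ m) u))\<^sup>2) * cis \<phi> + of_real (E ^ m) * cinner H ((A ^^ m) u) u"
    unfolding g by (simp only: distrib_left mult.assoc[symmetric] mult.commute[of "cis \<phi>" "of_real _"])
  then have "Re (cis \<phi> * g (m - 1)) = (hnorm H ((A ^^ m) u))\<^sup>2 * cos \<phi> + E ^ m * Re (cinner H ((A ^^ m) u) u)"
    by (simp flip: of_real_power)
  also have "0 \<le> \<dots>"
    using cos E accretiveD[OF acc u] by simp
  finally have "0 \<le> (E * real m) * Re (cis \<phi> * g (m - 1))"
    using E by simp
  also have "\<dots> = Re (of_real (E * real m) * (cis \<phi> * g (m - 1)))"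
    by (simp only: Re_complex_of_real times_complex.sel Im_complex_of_real)
  also have "of_real (E * real m) * (cis \<phi> * g (m - 1)) = cis (\<phi> - \<beta>) * (v 0 * (of_nat m * g (m - 1)))"
  proof -
    have "cis (\<phi> - \<beta>) * v 0 = of_real E * cis \<phi>"
      unfolding v_polar by (simp add: cis_mult mult.left_commute)
    then have "cis (\<phi> - \<beta>) * (v 0 * (of_nat m * g (m - 1))) = of_real E * cis \<phi> * (of_nat m * g (m - 1))"
      by (simp only: mult.assoc[symmetric])
    then show ?thesis by (simp only:) (simp add: mult_ac)
  qed
  finally show ?thesis unfolding total .
qed

text \<open>
  Lemma \<open>rotated_strip_sum\<close> is applied to the lines whose angles \<open>\<beta> + 2 pi j / m\<close> are those of the numbers
  \<open>v j\<close>; the condition \<open>\<bar>\<phi>\<bar> < pi / 2\<close> keeps all of them inside the strip.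
\<close>

lemma sector_bound_on_range:
  assumes m: "2 \<le> n k" and \<phi>: "\<bar>\<phi>\<bar> < pi / 2"
  shows "\<exists>N. \<forall>h\<in>carrier H. 0 \<le> Re (cis (\<phi> * (1 - 1 / real (n k))) *
    cinner H (A ((A ^^ N) h)) ((A ^^ N) h))"
proof -
  define m where "m = n k"
  define \<beta> where "\<beta> = - pi + (pi + \<phi>) / real m"
  \<comment> \<open>The first line has angle \<open>\<beta>\<close>, the last one \<open>pi - (pi - \<phi>) / m\<close>.\<close>
  define b where "b = max (- \<beta>) (pi - (pi - \<phi>) / real m)"
  have m2: "2 \<le> m" using m by (simp add: m_def)
  have "0 < (pi + \<phi>) / real m" "0 < (pi - \<phi>) / real m"
    using \<phi> m2 by (auto intro!: divide_pos_pos)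
  then have b: "b < pi" by (simp add: b_def \<beta>_def)
  have \<beta>_last: "\<beta> + 2 * pi * (real m - 1) / real m \<le> b"
  proof -
    have "\<beta> + 2 * pi * (real m - 1) / real m = pi - (pi - \<phi>) / real m"
      using m2 by (simp add: \<beta>_def field_simps)
    then show ?thesis by (simp add: b_def)
  qed
  have range: "\<bar>\<beta> + 2 * pi * real j / real m\<bar> < pi" if "j < m" for j
  proof -
    have "2 * pi * real j / real m \<le> 2 * pi * (real m - 1) / real m"
      using that by (intro divide_right_mono mult_left_mono) auto
    moreover have "0 \<le> 2 * pi * real j / real m" by simp
    moreover have "- b \<le> \<beta>" by (simp add: b_def)
    ultimately show ?thesis using \<beta>_last b by linarith
  qed
  obtain N where N: "\<And>h y e. h \<in> carrier H \<Longrightarrow> y \<in> carrier H \<Longrightarrow> 0 < e \<Longrightarrow>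
    \<exists>T. \<forall>z. Re z \<le> T \<longrightarrow> \<bar>Im z\<bar> \<le> b \<longrightarrow>
      cmod (exp z * cinner H (A (resolvent (exp z) ((A ^^ N) h))) y) \<le> e"
    using resolvent_form_at_bot[OF b] by metis
  have "0 \<le> Re (cis (\<phi> * (1 - 1 / real m)) * cinner H (A ((A ^^ N) h)) ((A ^^ N) h))"
    if h: "h \<in> carrier H" for h
  proof -
    define x where "x = (A ^^ N) h"
    have x: "x \<in> carrier H" unfolding x_def by (rule power_closed[OF bounded h])
    have "Re (cis (\<phi> - \<beta>) * cinner H (A x) x * cis (pi / real m)) \<le> 0"
    proof (rule rotated_strip_sum[OF resolvent_form_holomorphic[OF x x] m2 b _ \<beta>_last])
      show "- b \<le> \<beta>" by (simp add: b_def)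
      show "\<exists>T. \<forall>z. T \<le> Re z \<longrightarrow> \<bar>Im z\<bar> \<le> b \<longrightarrow>
          cmod (exp z * cinner H (A (resolvent (exp z) x)) x - cinner H (A x) x) \<le> e" if "0 < e" for e
        by (rule resolvent_form_at_top[OF x x that b])
      show "\<exists>T. \<forall>z. Re z \<le> T \<longrightarrow> \<bar>Im z\<bar> \<le> b \<longrightarrow>
          cmod (exp z * cinner H (A (resolvent (exp z) x)) x) \<le> e" if "0 < e" for e
        using N[OF h x that] unfolding x_def[symmetric] .
    next
      fix t
      show "0 \<le> Re (cis (\<phi> - \<beta>) * (\<Sum>j<m. cis (- (2 * pi * real j / real m)) *
          (exp (of_real t + \<i> * of_real (\<beta> + 2 * pi * real j / real m)) *
            cinner H (A (resolvent (exp (of_real t + \<i> * of_real (\<beta> + 2 * pi * real j / real m))) x)) x)))"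
        by (rule rotated_resolvents_nonneg[OF \<phi> x m_def \<beta>_def range refl])
    qed
    moreover have "cis (\<phi> - \<beta>) * cis (pi / real m) = - cis (\<phi> * (1 - 1 / real m))"
    proof -
      have "\<phi> - \<beta> + pi / real m = \<phi> * (1 - 1 / real m) + pi"
        using m2 by (simp add: \<beta>_def field_simps)
      then show ?thesis by (simp add: cis_mult) (simp add: cis_mult[symmetric])
    qed
    then have "cis (\<phi> - \<beta>) * cinner H (A x) x * cis (pi / real m) = - (cis (\<phi> * (1 - 1 / real m)) * cinner H (A x) x)"
      by (metis mult.assoc mult.commute mult_minus_left)
    ultimately show ?thesis unfolding x_def[symmetric] by simp
  qed
  then show ?thesis unfolding m_def by metis
qed

text \<open>
  Write \<open>x = A e + D\<close> with \<open>D = s e\<close>, \<open>s > 0\<close> small.  If \<open>x\<close> lies in the range of \<open>A\<^sup>N\<close>, then \<open>A e\<close> lies in the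
  range of \<open>A\<^sup>N\<^sup>+\<^sup>1\<close>, so the inequality is known for \<open>A e\<close>.  It remains to see that \<open>\<langle>A x, x\<rangle>\<close> and
  \<open>\<langle>A (A e), A e\<rangle>\<close> differ by a quantity that vanishes with \<open>s\<close>.  The part involving \<open>A D = s A e\<close> is clear.
  The other part \<open>\<langle>A x, D\<rangle>\<close> is controlled by the Cauchy-Schwarz argument for the positive form
  \<open>Re \<langle>A y, y\<rangle>\<close>, for which \<open>D\<close> is almost a null vector.
\<close>

lemma sector_bound_range_Suc:
  assumes c: "cmod c = 1"
    and bound: "\<And>h. h \<in> carrier H \<Longrightarrow> 0 \<le> Re (c * cinner H (A ((A ^^ Suc N) h)) ((A ^^ Suc N) h))"
    and h: "h \<in> carrier H"
  shows "0 \<le> Re (c * cinner H (A ((A ^^ N) h)) ((A ^^ N) h))"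
proof -
  define x where "x = (A ^^ N) h"
  have x: "x \<in> carrier H" unfolding x_def by (rule power_closed[OF bounded h])
  define a where "a = cinner H (A x) x"
  define S where "S = (hnorm H x)\<^sup>2"
  define G where "G = \<kappa> * S"
  have S: "0 \<le> S" by (simp add: S_def)
  have G: "0 \<le> G" using \<kappa> S by (simp add: G_def)
  have accA: "accretive A" using accretive_power[of 0] by (simp add: n_0)
  \<comment> \<open>The bound for the defect when \<open>s = \<sigma>\<^sup>2\<close>; the square root comes from the Cauchy-Schwarz argument.\<close>
  define F where "F \<sigma> = sqrt (\<sigma> * (S + \<sigma> * G * S + G\<^sup>2 * cmod a)) + \<sigma>\<^sup>2 * S" for \<sigma> :: real
  have est: "- F \<sigma> \<le> Re (c * a)" if \<sigma>: "0 < \<sigma>" for \<sigma>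
  proof -
    define s where "s = \<sigma>\<^sup>2"
    have s: "0 < s" using \<sigma> by (simp add: s_def)
    have "\<exists>u\<in>carrier H. A u \<oplus> of_real s \<odot> u = h"
      by (rule accretive_add_scalar_surj[OF bounded accA _ h]) (simp add: s)
    then obtain d where d: "d \<in> carrier H" "A d \<oplus> of_real s \<odot> d = h" by metis
    note AN = bounded_operator_simps[OF bounded_operator_power[OF bounded, of N]]
    define e where "e = (A ^^ N) d"
    have e: "e \<in> carrier H" unfolding e_def by (rule power_closed[OF bounded d(1)])
    have xe: "x = A e \<oplus> of_real s \<odot> e"
      unfolding x_def d(2)[symmetric] e_def using d(1) by (simp add: AN A_simps funpow_swap1)
    have Ae: "A e \<in> carrier H" using e by (simp add: A_simps)
    have Ae_eq: "A e = (A ^^ Suc N) d" by (simp add: e_def)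
    have nonneg: "0 \<le> Re (c * cinner H (A (A e)) (A e))"
      unfolding Ae_eq by (rule bound[OF d(1)])
    define D where "D = of_real s \<odot> e"
    have D: "D \<in> carrier H" using e by (simp add: D_def)
    have xD: "x = A e \<oplus> D" by (simp add: xe D_def)
    have AD: "A D = of_real s \<odot> A e" using e by (simp add: D_def A_simps)
    have S_eq: "S = (hnorm H (A e))\<^sup>2 + (hnorm H D)\<^sup>2 + 2 * (s * Re (cinner H (A e) e))"
      unfolding S_def xD hnorm_add_power2[OF Ae D] using e by (simp add: D_def cinner_simps A_simps)
    have pos: "0 \<le> s * Re (cinner H (A e) e)"
      using s accretiveD[OF accA e] by simp
    have Ae_le: "(hnorm H (A e))\<^sup>2 \<le> S" and D_le: "(hnorm H D)\<^sup>2 \<le> S"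
      using S_eq pos by (auto simp: add_increasing)
    have Ae_n: "hnorm H (A e) \<le> hnorm H x" and D_n: "hnorm H D \<le> hnorm H x"
      using Ae_le D_le x unfolding S_def by (auto intro: power2_le_imp_le)
    have AD_le: "cmod (cinner H (A D) y) \<le> s * S" if y: "y \<in> carrier H" "hnorm H y \<le> hnorm H x" for y
    proof -
      have "cmod (cinner H (A D) y) = s * cmod (cinner H (A e) y)"
        unfolding AD using Ae y s by (simp add: cinner_simps norm_mult)
      also have "\<dots> \<le> s * (hnorm H (A e) * hnorm H y)"
        using s by (intro mult_left_mono Cauchy_Schwarz Ae y) simp
      also have "\<dots> \<le> s * (hnorm H x * hnorm H x)"
        using s x y Ae_n Ae by (intro mult_left_mono mult_mono) simp_all
      finally show ?thesis by (simp add: S_def power2_eq_square)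
    qed
    define g where "g = cinner H (A x) D"
    have g_le_G: "cmod g \<le> G"
    proof -
      have "cmod g \<le> \<kappa> * hnorm H x * hnorm H D"
        unfolding g_def by (rule cmod_cinner_A_le[OF x D])
      also have "\<dots> \<le> \<kappa> * hnorm H x * hnorm H x"
        using \<kappa> x D_n by (intro mult_left_mono) simp_all
      finally show ?thesis by (simp add: G_def S_def power2_eq_square)
    qed
    have "\<sigma> * (cmod g)\<^sup>2 \<le> s * (S + \<sigma> * G * S + G\<^sup>2 * cmod a)"
    proof -
      \<comment> \<open>Testing accretivity on \<open>D + \<zeta> x\<close> with this phase makes the cross term equal to \<open>- \<sigma> \<bar>g\<bar>\<^sup>2\<close>.\<close>
      define \<zeta> where "\<zeta> = - of_real \<sigma> * cnj g"
      define y where "y = D \<oplus> \<zeta> \<odot> x"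
      have y: "y \<in> carrier H" using D x by (simp add: y_def)
      have "cinner H (A y) y = cinner H (A D) D + cnj \<zeta> * cinner H (A D) x + \<zeta> * g + (\<zeta> * cnj \<zeta>) * a"
        using D x by (simp add: y_def g_def a_def A_simps cinner_simps algebra_simps)
      moreover have "\<zeta> * g = of_real (- \<sigma> * (cmod g)\<^sup>2)"
        using complex_norm_square[of g] by (simp add: \<zeta>_def mult.commute)
      ultimately have "0 \<le> Re (cinner H (A D) D) + Re (cnj \<zeta> * cinner H (A D) x) - \<sigma> * (cmod g)\<^sup>2
          + Re ((\<zeta> * cnj \<zeta>) * a)"
        using accretiveD[OF accA y] by simp
      moreover have "Re (cinner H (A D) D) \<le> s * S"
        by (rule order_trans[OF complex_Re_le_cmod AD_le[OF D D_n]])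
      moreover have "Re (cnj \<zeta> * cinner H (A D) x) \<le> (\<sigma> * G) * (s * S)"
      proof -
        have "Re (cnj \<zeta> * cinner H (A D) x) \<le> cmod \<zeta> * cmod (cinner H (A D) x)"
          by (metis complex_Re_le_cmod complex_mod_cnj norm_mult)
        also have "\<dots> \<le> (\<sigma> * G) * (s * S)"
          using \<sigma> g_le_G G by (intro mult_mono AD_le x) (simp_all add: \<zeta>_def norm_mult)
        finally show ?thesis .
      qed
      moreover have "Re ((\<zeta> * cnj \<zeta>) * a) \<le> (\<sigma> * G)\<^sup>2 * cmod a"
      proof -
        have "Re ((\<zeta> * cnj \<zeta>) * a) \<le> (cmod \<zeta>)\<^sup>2 * cmod a"
          by (metis complex_Re_le_cmod complex_mod_mult_cnj norm_mult)
        also have "\<dots> \<le> (\<sigma> * G)\<^sup>2 * cmod a"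
          using \<sigma> g_le_G by (intro mult_right_mono power_mono) (simp_all add: \<zeta>_def norm_mult)
        finally show ?thesis .
      qed
      ultimately show ?thesis
        by (simp add: s_def power_mult_distrib algebra_simps)
    qed
    then have "\<sigma> * (cmod g)\<^sup>2 \<le> \<sigma> * (\<sigma> * (S + \<sigma> * G * S + G\<^sup>2 * cmod a))"
      by (simp only: s_def power2_eq_square mult.assoc)
    then have "(cmod g)\<^sup>2 \<le> \<sigma> * (S + \<sigma> * G * S + G\<^sup>2 * cmod a)"
      using \<sigma> by (rule mult_left_le_imp_le)
    then have g_le: "cmod g \<le> sqrt (\<sigma> * (S + \<sigma> * G * S + G\<^sup>2 * cmod a))"
      by (rule real_le_rsqrt)
    have "a = cinner H (A (A e)) (A e) + cinner H (A D) (A e) + g"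
    proof -
      have "a = cinner H (A x) (A e) + g"
        unfolding a_def g_def using x Ae D by (subst (2) xD) (simp add: cinner_simps A_simps)
      also have "cinner H (A x) (A e) = cinner H (A (A e)) (A e) + cinner H (A D) (A e)"
        unfolding xD using Ae D by (simp add: cinner_simps A_simps)
      finally show ?thesis .
    qed
    then have "Re (c * a) = Re (c * cinner H (A (A e)) (A e)) + Re (c * cinner H (A D) (A e)) + Re (c * g)"
      by (simp only: distrib_left plus_complex.sel)
    moreover have "- (s * S) \<le> Re (c * cinner H (A D) (A e))"
      using abs_Re_le_cmod[of "c * cinner H (A D) (A e)"] AD_le[OF Ae Ae_n] c by (simp only: norm_mult)
    moreover have "- cmod g \<le> Re (c * g)"
      using abs_Re_le_cmod[of "c * g"] c by (simp add: norm_mult)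
    ultimately show ?thesis
      using nonneg g_le unfolding F_def s_def by linarith
  qed
  have "((\<lambda>\<sigma>. - F \<sigma>) \<longlongrightarrow> - F 0) (at_right 0)"
    unfolding F_def by (intro tendsto_intros)
  then have lim: "((\<lambda>\<sigma>. - F \<sigma>) \<longlongrightarrow> 0) (at_right 0)"
    by (simp add: F_def)
  have "0 \<le> Re (c * a)"
    by (rule tendsto_upperbound[OF lim eventually_mono[OF eventually_at_right_less est]]) simp_all
  then show ?thesis by (simp only: a_def x_def)
qed

lemma sector_bound:
  assumes m: "2 \<le> n k" and \<phi>: "\<bar>\<phi>\<bar> < pi / 2" and x: "x \<in> carrier H"
  shows "0 \<le> Re (cis (\<phi> * (1 - 1 / real (n k))) * cinner H (A x) x)"
proof -
  let ?c = "cis (\<phi> * (1 - 1 / real (n k)))"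
  have step: "(\<forall>h\<in>carrier H. 0 \<le> Re (?c * cinner H (A ((A ^^ N) h)) ((A ^^ N) h))) \<Longrightarrow>
      0 \<le> Re (?c * cinner H (A x) x)" for N
  proof (induction N)
    case 0
    then show ?case using x by simp
  next
    case (Suc N)
    then show ?case
      using sector_bound_range_Suc[OF norm_cis, of _ N] by metis
  qed
  show ?thesis
    using sector_bound_on_range[OF m \<phi>] step by metis
qed

lemma operator_positive: "positive_operator H A"
  unfolding positive_operator_def
proof
  fix x assume x: "x \<in> carrier H"
  define a where "a = cinner H (A x) x"
  have "0 \<le> Re a"
    using accretiveD[OF accretive_power[of 0] x] by (simp add: n_0 a_def)
  moreover have "Im a * r \<le> 0" if r: "\<bar>r\<bar> = 1" for r :: real
  proof -
    \<comment> \<open>The angles approach \<open>pi / 2\<close> or \<open>- pi / 2\<close> from inside while the exponents tend to infinity, so in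
      the limit \<open>\<langle>A x, x\<rangle>\<close> is multiplied by \<open>\<i>\<close> or \<open>- \<i>\<close>.\<close>
    define \<phi> where "\<phi> k = r * (pi / 2) * (1 - 1 / real (n k))" for k
    have n_top: "filterlim (\<lambda>k. real (n k)) at_top sequentially"
      using filterlim_subseq[OF strict_mono_n] filterlim_real_sequentially
      by (rule filterlim_compose[rotated])
    have inv: "(\<lambda>k. 1 / real (n k)) \<longlonglongrightarrow> 0"
      using tendsto_inverse_0_at_top[OF n_top] by (simp add: inverse_eq_divide)
    have lim: "(\<lambda>k. Re (cis (\<phi> k * (1 - 1 / real (n k))) * a)) \<longlonglongrightarrow>
        Re (cis (r * (pi / 2) * (1 - 0) * (1 - 0)) * a)"
      unfolding \<phi>_def by (intro tendsto_intros tendsto_Re inv tendsto_mult tendsto_cis tendsto_diff)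
    have "0 \<le> Re (cis (\<phi> k * (1 - 1 / real (n k))) * a)" if "1 \<le> k" for k
    proof -
      have "n 0 < n k" using strict_mono_n that by (auto simp: strict_mono_less)
      then have k: "2 \<le> n k" by (simp add: n_0)
      have "\<bar>\<phi> k\<bar> < pi / 2"
      proof -
        have "0 < 1 / real (n k)" "1 / real (n k) \<le> 1" using k by simp_all
        then have "\<bar>1 - 1 / real (n k)\<bar> < 1" by linarith
        then show ?thesis using r by (simp add: \<phi>_def abs_mult)
      qed
      then show ?thesis unfolding a_def by (rule sector_bound[OF k _ x])
    qed
    then have "0 \<le> Re (cis (r * (pi / 2) * (1 - 0) * (1 - 0)) * a)"
      by (intro LIMSEQ_le_const[OF lim]) blast
    moreover have "cis (r * (pi / 2) * (1 - 0) * (1 - 0)) = \<i> * of_real r"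
      using r by (auto simp: abs_if complex_eq_iff split: if_splits)
    ultimately have "0 \<le> Re (\<i> * of_real r * a)"
      by (simp only:)
    then show ?thesis by (simp add: mult.commute)
  qed
  from this[of 1] this[of "- 1"] have "Im a = 0" by simp
  ultimately show "cinner H (A x) x \<in> \<real>\<^sub>\<ge>\<^sub>0"
    by (simp add: a_def complex_nonneg_Reals_iff)
qed

end

section \<open>The one-dimensional Hilbert space\<close>

text \<open>
  The complex numbers, placed in the second summand of the universe.
\<close>

definition complex_line :: "('u + complex) hilbert" where
  "complex_line =
    \<lparr>carrier = range Inr, monoid.mult = (\<lambda>x y. x), one = Inr 0,
     ring.zero = Inr 0, add = (\<lambda>x y. Inr (projr x + projr y)),
     smult = (\<lambda>c x. Inr (c * projr x)),
     cinner = (\<lambda>x y. projr x * cnj (projr y))\<rparr>"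

lemma complex_line_simps [simp]:
  "carrier complex_line = range Inr"
  "\<zero>\<^bsub>complex_line\<^esub> = Inr 0"
  "Inr a \<oplus>\<^bsub>complex_line\<^esub> Inr b = Inr (a + b)"
  "c \<odot>\<^bsub>complex_line\<^esub> Inr a = Inr (c * a)"
  "cinner complex_line (Inr a) (Inr b) = a * cnj b"
  by (simp_all add: complex_line_def)

lemma complex_line_abelian_group: "abelian_group complex_line"
proof (rule abelian_groupI)
  fix x :: "'a + complex" assume "x \<in> carrier complex_line"
  then obtain a where "x = Inr a" by auto
  then show "\<exists>y\<in>carrier complex_line. y \<oplus>\<^bsub>complex_line\<^esub> x = \<zero>\<^bsub>complex_line\<^esub>"
    by (intro bexI[of _ "Inr (- a)"]) auto
qed (auto simp: algebra_simps)

lemma complex_line_diff: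
  "Inr a \<ominus>\<^bsub>complex_line :: ('u + complex) hilbert\<^esub> Inr b = Inr (a - b)"
proof -
  interpret abelian_group "complex_line :: ('u + complex) hilbert" by (rule complex_line_abelian_group)
  have "\<ominus>\<^bsub>complex_line :: ('u + complex) hilbert\<^esub> Inr b = Inr (- b)"
    by (rule minus_equality) auto
  then show ?thesis by (simp add: a_minus_def)
qed

lemma complex_line_hnorm: "hnorm complex_line (Inr a) = cmod a"
  using complex_norm_square[of a] by (simp add: hnorm_def cmod_def power2_eq_square)

lemma complex_line_hdist: "hdist complex_line (Inr a) (Inr b) = dist a b"
  by (simp add: hdist_def complex_line_diff complex_line_hnorm dist_norm)

lemma complex_line_complete:
  "Metric_space.mcomplete (carrier (complex_line :: ('u + complex) hilbert)) (hdist complex_line)"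
proof -
  interpret Metric_space "carrier (complex_line :: ('u + complex) hilbert)" "hdist complex_line"
  proof
    show "0 \<le> hdist complex_line x y" for x y :: "'u + complex"
      by (cases x; cases y) (simp_all add: complex_line_hdist, simp_all add: hdist_def image_iff)
    show "hdist complex_line x y = hdist complex_line y x" for x y :: "'u + complex"
      by (cases x; cases y) (simp_all add: complex_line_hdist dist_commute, simp_all add: hdist_def image_iff)
  qed (auto simp: complex_line_hdist dist_triangle)
  show ?thesis
    unfolding mcomplete_def
  proof (intro allI impI)
    fix s :: "nat \<Rightarrow> 'u + complex" assume s: "MCauchy s"
    define f where "f i = projr (s i)" for i
    have "s i \<in> range Inr" for i
      using s unfolding MCauchy_def by (simp add: image_subset_iff)
    then have sf: "s i = Inr (f i)" for i
      unfolding f_def by (metis f_inv_into_f sum.sel(2))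
    have "Cauchy f"
      using s unfolding MCauchy_def Cauchy_def by (simp add: sf complex_line_hdist)
    then obtain z where z: "f \<longlonglongrightarrow> z"
      using convergent_eq_Cauchy by metis
    then have "limitin mtopology s (Inr z) sequentially"
      unfolding limit_metric_sequentially by (auto simp: sf complex_line_hdist lim_sequentially)
    then show "\<exists>x. limitin mtopology s x sequentially" ..
  qed
qed

lemma complex_line_hilbert_space: "complex_hilbert_space complex_line"
proof -
  have "module (ring_of_type_algebra :: complex ring) complex_line"
    by (rule moduleI[OF cring_from_type_algebra complex_line_abelian_group])
      (auto simp: algebra_simps)
  then show ?thesis
    by (intro complex_hilbert_space.intro complex_hilbert_space_axioms.intro complex_line_complete)
      (auto simp: algebra_simps complex_nonneg_Reals_iff)
qed

lemma complex_line_scaling: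
  fixes c :: complex
  defines "A \<equiv> \<lambda>x :: 'u + complex. Inr (c * projr x)"
  shows "bounded_operator complex_line A"
    and "positive_operator complex_line A \<longleftrightarrow> c \<in> \<real>\<^sub>\<ge>\<^sub>0"
    and "0 \<le> Re (c ^ m) \<Longrightarrow> positive_operator complex_line (Re_operator complex_line (A ^^ m))"
proof -
  interpret complex_hilbert_space "complex_line :: ('u + complex) hilbert"
    by (rule complex_line_hilbert_space)
  show A: "bounded_operator complex_line A"
    by (rule bounded_operatorI[where K = "cmod c"])
      (auto simp: A_def complex_line_hnorm norm_mult algebra_simps)
  have form: "c * (a * cnj a) = of_real ((cmod a)\<^sup>2) * c" for a c
    using complex_norm_square[of a] by (simp add: mult.commute)
  show "positive_operator complex_line A \<longleftrightarrow> c \<in> \<real>\<^sub>\<ge>\<^sub>0"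
  proof
    assume "positive_operator complex_line A"
    then have "cinner complex_line (A (Inr 1)) (Inr 1) \<in> \<real>\<^sub>\<ge>\<^sub>0"
      unfolding positive_operator_def by (rule bspec) simp
    then show "c \<in> \<real>\<^sub>\<ge>\<^sub>0" by (simp add: A_def)
  next
    assume "c \<in> \<real>\<^sub>\<ge>\<^sub>0"
    then show "positive_operator complex_line A"
      by (auto simp: positive_operator_def A_def mult.assoc form intro!: nonneg_Reals_mult_I)
  qed
  assume c: "0 \<le> Re (c ^ m)"
  have "(A ^^ m) (Inr a) = Inr (c ^ m * a)" for a
    by (induction m) (simp_all add: A_def)
  then have "accretive (A ^^ m)"
    using c by (auto simp: accretive_def mult.assoc form simp flip: of_real_power)
  then show "positive_operator complex_line (Re_operator complex_line (A ^^ m))"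
    using positive_Re_operator_iff[OF bounded_operator_power[OF A]] by simp
qed

section \<open>Equivalence of the three assertions\<close>

lemma norm_diff_one_le_sqrt2_iff:
  assumes "norm w = 1"
  shows "norm (w - 1 :: complex) \<le> sqrt 2 \<longleftrightarrow> 0 \<le> Re w"
proof -
  have "(Re w)\<^sup>2 + (Im w)\<^sup>2 = 1"
    using assms by (simp add: cmod_def)
  then have "norm (w - 1) = sqrt (2 - 2 * Re w)"
    by (simp add: cmod_def power2_diff)
  then show ?thesis by simp
qed

(* Assertion (a) ranges over all Hilbert spaces whose underlying set consists of elements of
   'u + complex. HOL formulas cannot quantify over types, so this type serves as the universe:
   'u is arbitrary, every set embeds into such a type, and the summand complex only ensures
   that the universe is large enough to contain a nonzero Hilbert space. *)
theorem theorem2p11: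
  fixes n :: "nat \<Rightarrow> nat"
  assumes "strict_mono n" and "\<forall>k. n k > 0" and "n 0 = 1"
  shows
    "((\<forall>(H :: ('u + complex) hilbert) A.
         complex_hilbert_space H \<longrightarrow> bounded_operator H A \<longrightarrow>
         (\<forall>k. positive_operator H (Re_operator H (A ^^ n k))) \<longrightarrow>
         positive_operator H A)
      \<longleftrightarrow>
      (\<forall>c :: complex. (\<forall>k. Re (c ^ n k) \<ge> 0) \<longrightarrow> c \<in> \<real> \<and> Re c \<ge> 0))
     \<and>
     ((\<forall>c :: complex. (\<forall>k. Re (c ^ n k) \<ge> 0) \<longrightarrow> c \<in> \<real> \<and> Re c \<ge> 0)
      \<longleftrightarrow>
      (\<forall>z :: complex. norm z = 1 \<longrightarrow> (SUP k. norm (z ^ n k - 1)) \<le> sqrt 2 \<longrightarrow> z = 1))"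
    (is "(?a \<longleftrightarrow> ?b) \<and> (?b \<longleftrightarrow> ?c)")
proof (intro conjI iffI)
  assume a: ?a
  show ?b
  proof (intro allI impI)
    fix c :: complex assume c: "\<forall>k. Re (c ^ n k) \<ge> 0"
    let ?A = "\<lambda>x :: 'u + complex. Inr (c * projr x)"
    have "positive_operator complex_line ?A"
      using a[rule_format, OF complex_line_hilbert_space complex_line_scaling(1), of c]
        complex_line_scaling(3)[of c, where 'u = 'u] c by metis
    then have "c \<in> \<real>\<^sub>\<ge>\<^sub>0"
      by (simp only: complex_line_scaling(2))
    then show "c \<in> \<real> \<and> Re c \<ge> 0"
      by (simp add: complex_nonneg_Reals_iff complex_is_Real_iff)
  qed
next
  assume b: ?b
  show ?a
  proof (intro allI impI)
    fix H :: "('u + complex) hilbert" and A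
    assume H: "complex_hilbert_space H" and A: "bounded_operator H A"
      and pos: "\<forall>k. positive_operator H (Re_operator H (A ^^ n k))"
    interpret complex_hilbert_space H by (rule H)
    interpret accretive_powers H A n
    proof
      show "accretive (A ^^ n k)" for k
        using pos positive_Re_operator_iff[OF bounded_operator_power[OF A]] by simp
      show "\<exists>k. Re (c ^ n k) < 0" if "c \<notin> \<real>\<^sub>\<ge>\<^sub>0" for c
        using b[rule_format, of c] that
        by (auto simp: complex_nonneg_Reals_iff complex_is_Real_iff not_less[symmetric])
    qed (fact A assms)+
    show "positive_operator H A" by (rule operator_positive)
  qed
next
  have sup_iff: "(SUP k. norm (z ^ n k - 1)) \<le> sqrt 2 \<longleftrightarrow> (\<forall>k. 0 \<le> Re (z ^ n k))"
    if z: "norm z = 1" for z :: complex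
  proof -
    have norm_pow: "norm (z ^ n k) = 1" for k using z by (simp add: norm_power)
    have "norm (z ^ n k - 1) \<le> 2" for k
      using norm_triangle_ineq4[of "z ^ n k" 1] by (simp add: norm_pow)
    then have "bdd_above (range (\<lambda>k. norm (z ^ n k - 1)))"
      by (intro bdd_aboveI2)
    then have "(SUP k. norm (z ^ n k - 1)) \<le> sqrt 2 \<longleftrightarrow> (\<forall>k. norm (z ^ n k - 1) \<le> sqrt 2)"
      by (subst cSUP_le_iff) auto
    then show ?thesis by (simp only: norm_diff_one_le_sqrt2_iff[OF norm_pow])
  qed
  {
    assume b: ?b
    show ?c
    proof (intro allI impI)
      fix z :: complex assume z: "norm z = 1" "(SUP k. norm (z ^ n k - 1)) \<le> sqrt 2"
      then have "z \<in> \<real>" "0 \<le> Re z" using b sup_iff by auto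
      then show "z = 1"
        using z(1) by (auto elim!: Reals_cases)
    qed
  next
    assume c: ?c
    show ?b
    proof (intro allI impI)
      fix w :: complex assume w: "\<forall>k. Re (w ^ n k) \<ge> 0"
      show "w \<in> \<real> \<and> Re w \<ge> 0"
      proof (cases "w = 0")
        case False
        define z where "z = w / of_real (norm w)"
        have z: "norm z = 1" using False by (simp add: z_def norm_divide)
        have "Re (z ^ n k) = Re (w ^ n k) / norm w ^ n k" for k
          by (simp add: z_def power_divide flip: of_real_power)
        then have "0 \<le> Re (z ^ n k)" for k using w by simp
        then have "z = 1" using c z sup_iff[OF z] by blast
        then have "w = of_real (norm w)" using False by (simp add: z_def)
        then show ?thesis by (metis Re_complex_of_real Reals_of_real norm_ge_zero)
      qed simp
    qed
  }
qed

end
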